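(* Let $n\ge3$ and let $B=B_{1/e}\subseteq\mathbb{R}^n$ be the ball with radius $1/e$ centered at $0$. Let $q>1$ and $\delta>0$, and set $c_\delta=\delta c$, where $$c(x)=-\frac{x}{|x|^2\ln|x|},\qquad x\in B.$$ Then $c_\delta\in L^{n,q}(B)$, $\|c_\delta\|_{L^{n,q}(B)}\le\delta\|c\|_{L^{n,q}(B)}$, and if $g_x^\delta(y)=g^\delta(y,x)$ is Green's function for the operator $-\Delta u-\operatorname{div}(c_\delta u)$ in $B$, then there is no constant $C>0$ such that the bound $$g^\delta(y,x)\le C|y-x|^{2-n}$$ holds for almost every $x,y\in B$.
   Context: Lorentz norm: with $f^*(s)=\inf\{t>0:|\{x\in B:|f(x)|>t\}|\le s\}$, $\|f\|_{L^{n,q}(B)}=\left(\int_0^\infty(t^{1/n}f^*(t))^q\frac{dt}{t}\right)^{1/q}$ for $q<\infty$, and $\|f\|_{L^{n,\infty}(B)}=\sup_{t>0}t^{1/n}f^*(t)$. $g^\delta(y,x)=g^\delta_x(y)$ is Green's function for the operator $-\Delta u-\operatorname{div}(c_\delta u)$ in $B$ if $g^\delta_x\in L^1(B)$ for almost every $x\in B$, and if for any bounded and compactly supported $f$ in $B$ the function $u(x)=\int_B g^\delta(y,x)f(y)\,dy$ is a $Y_0^{1,2}(B)=W_0^{1,2}(B)$ solution to the adjoint equation $-\Delta u+c_\delta\nabla u=f$ in $B$, i.e. $\int_B\nabla u\nabla\phi+c_\delta\nabla u\cdot\phi=\int_B f\phi$ for all $\phi\in C_c^\infty(B)$. *)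

theory Defs
  imports "HOL-Analysis.Analysis"
begin

section \<open>Lorentz spaces\<close>

text \<open>Only used for exponents \<open>p > 0\<close>.\<close>
definition enn_powr :: "ennreal \<Rightarrow> real \<Rightarrow> ennreal" where
  "enn_powr x p = (if x = top then top else ennreal (enn2real x powr p))"

text \<open>The infimum is taken in \<^typ>\<open>ennreal\<close>, so that it is \<open>top\<close> if no admissible \<open>t\<close> exists.\<close>
definition decr_rearr ::
    "'a::euclidean_space set \<Rightarrow> ('a \<Rightarrow> 'b::real_normed_vector) \<Rightarrow> real \<Rightarrow> ennreal" where
  "decr_rearr \<Omega> f s =
     Inf {ennreal t | t. t > 0 \<and> emeasure lebesgue {x \<in> \<Omega>. norm (f x) > t} \<le> ennreal s}"

definition lorentz_norm ::
    "real \<Rightarrow> ennreal \<Rightarrow> 'a::euclidean_space set \<Rightarrow> ('a \<Rightarrow> 'b::real_normed_vector) \<Rightarrow> ennreal" where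
  "lorentz_norm p q \<Omega> f =
     (if q = top
      then (SUP t\<in>{0<..}. ennreal (t powr (1 / p)) * decr_rearr \<Omega> f t)
      else enn_powr
        (\<integral>\<^sup>+t\<in>{0<..}. enn_powr (ennreal (t powr (1 / p)) * decr_rearr \<Omega> f t) (enn2real q)
           * ennreal (1 / t) \<partial>lborel)
        (1 / enn2real q))"

definition lorentz_space ::
    "real \<Rightarrow> ennreal \<Rightarrow> 'a::euclidean_space set \<Rightarrow> ('a \<Rightarrow> 'b::euclidean_space) set" where
  "lorentz_space p q \<Omega> =
     {f. f \<in> borel_measurable (lebesgue_on \<Omega>) \<and> lorentz_norm p q \<Omega> f < top}"

section \<open>Test functions and Sobolev spaces\<close>

definition grad :: "(real^'n \<Rightarrow> real) \<Rightarrow> real^'n \<Rightarrow> real^'n" where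
  "grad f x = (\<chi> i. frechet_derivative f (at x) (axis i 1))"

primrec C_k :: "nat \<Rightarrow> (real^'n \<Rightarrow> real) \<Rightarrow> bool" where
  "C_k 0 f \<longleftrightarrow> continuous_on UNIV f"
| "C_k (Suc k) f \<longleftrightarrow> f differentiable_on UNIV \<and> (\<forall>i. C_k k (\<lambda>x. grad f x $ i))"

text \<open>Elements of \<open>C\<^sub>c\<^sup>\<infinity>(\<Omega>)\<close> are extended by zero to the whole space.\<close>
definition test_functions :: "(real^'n) set \<Rightarrow> (real^'n \<Rightarrow> real) set" where
  "test_functions \<Omega> =
     {\<phi>. (\<forall>k. C_k k \<phi>) \<and> compact (closure {x. \<phi> x \<noteq> 0}) \<and> closure {x. \<phi> x \<noteq> 0} \<subseteq> \<Omega>}"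

definition L2_space :: "'a::euclidean_space set \<Rightarrow> ('a \<Rightarrow> 'b::euclidean_space) set" where
  "L2_space \<Omega> =
     {f. f \<in> borel_measurable (lebesgue_on \<Omega>) \<and> integrable (lebesgue_on \<Omega>) (\<lambda>x. (norm (f x))\<^sup>2)}"

definition has_weak_gradient ::
    "(real^'n) set \<Rightarrow> (real^'n \<Rightarrow> real) \<Rightarrow> (real^'n \<Rightarrow> real^'n) \<Rightarrow> bool" where
  "has_weak_gradient \<Omega> u G \<longleftrightarrow>
     (\<forall>\<phi>\<in>test_functions \<Omega>.
        (\<integral>x. u x *\<^sub>R grad \<phi> x \<partial>lebesgue_on \<Omega>) = - (\<integral>x. \<phi> x *\<^sub>R G x \<partial>lebesgue_on \<Omega>))"

text \<open>\<open>W12_0 \<Omega> u G\<close>: the function \<open>u\<close> belongs to \<open>W\<^sub>0\<^sup>1\<^sup>,\<^sup>2(\<Omega>)\<close>, the closure of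
  \<open>C\<^sub>c\<^sup>\<infinity>(\<Omega>)\<close> in \<open>W\<^sup>1\<^sup>,\<^sup>2(\<Omega>)\<close>, and \<open>G\<close> is (a version of) its weak gradient.\<close>
definition W12_0 ::
    "(real^'n) set \<Rightarrow> (real^'n \<Rightarrow> real) \<Rightarrow> (real^'n \<Rightarrow> real^'n) \<Rightarrow> bool" where
  "W12_0 \<Omega> u G \<longleftrightarrow>
     u \<in> L2_space \<Omega> \<and> G \<in> L2_space \<Omega> \<and> has_weak_gradient \<Omega> u G \<and>
     (\<exists>\<phi>. (\<forall>k::nat. \<phi> k \<in> test_functions \<Omega>) \<and>
        (\<lambda>k. \<integral>x. (\<phi> k x - u x)\<^sup>2 \<partial>lebesgue_on \<Omega>) \<longlonglongrightarrow> 0 \<and>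
        (\<lambda>k. \<integral>x. (norm (grad (\<phi> k) x - G x))\<^sup>2 \<partial>lebesgue_on \<Omega>) \<longlonglongrightarrow> 0)"

section \<open>Green's functions\<close>

text \<open>\<open>W\<^sub>0\<^sup>1\<^sup>,\<^sup>2(\<Omega>)\<close> solutions of \<open>-\<Delta>u + b\<nabla>u = f\<close>. The integrability requirement only excludes
  the convention that the integral of a non-integrable function is zero; it holds
  automatically if \<open>b\<close> is locally square integrable in \<open>\<Omega>\<close>.\<close>
definition adjoint_solution ::
    "(real^'n) set \<Rightarrow> (real^'n \<Rightarrow> real^'n) \<Rightarrow> (real^'n \<Rightarrow> real) \<Rightarrow> (real^'n \<Rightarrow> real) \<Rightarrow> bool" where
  "adjoint_solution \<Omega> b f u \<longleftrightarrow>
     (\<exists>G. W12_0 \<Omega> u G \<and>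
        (\<forall>\<phi>\<in>test_functions \<Omega>.
           integrable (lebesgue_on \<Omega>) (\<lambda>x. G x \<bullet> grad \<phi> x + (b x \<bullet> G x) * \<phi> x) \<and>
           (\<integral>x. G x \<bullet> grad \<phi> x + (b x \<bullet> G x) * \<phi> x \<partial>lebesgue_on \<Omega>)
             = (\<integral>x. f x * \<phi> x \<partial>lebesgue_on \<Omega>)))"

definition bounded_cpt_supp :: "(real^'n) set \<Rightarrow> (real^'n \<Rightarrow> real) \<Rightarrow> bool" where
  "bounded_cpt_supp \<Omega> f \<longleftrightarrow>
     f \<in> borel_measurable lebesgue \<and> bounded (range f) \<and>
     compact (closure {x. f x \<noteq> 0}) \<and> closure {x. f x \<noteq> 0} \<subseteq> \<Omega>"

text \<open>\<open>g y x\<close> is Green's function for \<open>-\<Delta>u - div(b u)\<close> in \<open>\<Omega>\<close>, with pole \<open>x\<close>.\<close>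
definition is_green_function ::
    "(real^'n) set \<Rightarrow> (real^'n \<Rightarrow> real^'n) \<Rightarrow> (real^'n \<Rightarrow> real^'n \<Rightarrow> real) \<Rightarrow> bool" where
  "is_green_function \<Omega> b g \<longleftrightarrow>
     (AE x in lebesgue_on \<Omega>. integrable (lebesgue_on \<Omega>) (\<lambda>y. g y x)) \<and>
     (\<forall>f. bounded_cpt_supp \<Omega> f \<longrightarrow>
        adjoint_solution \<Omega> b f (\<lambda>x. \<integral>y. g y x * f y \<partial>lebesgue_on \<Omega>))"

end

theory Submission
  imports Defs "HOL-Real_Asymp.Real_Asymp"
begin

text \<open>
  Write \<open>n\<close> for the dimension, \<open>r = |x|\<close>, \<open>t = r\<^sup>2\<close> and \<open>L = - ln r\<close>, so that \<open>c = x / (r\<^sup>2 L)\<close>.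

  The drift lies in the Lorentz space because \<open>|c| = 1 / (r L)\<close> is decreasing in \<open>r\<close>: its
  rearrangement is at most \<open>1 / (r L)\<close> at the radius \<open>r\<close> of the ball of measure \<open>s\<close>, hence
  \<open>s powr (1 / n)\<close> times the rearrangement is at most a constant times \<open>1 / L\<close>. Since \<open>dL = - ds / (n s)\<close>,
  the Lorentz integral is at most a multiple of the integral of \<open>L powr - q\<close> over \<open>L > 1\<close>, which is
  finite for finite \<open>q > 1\<close>; for infinite \<open>q\<close> it suffices that \<open>1 / L < 1\<close>.

  The pointwise bound fails because Green's function has an additional logarithmic singularity:
  for fixed \<open>x\<close> it grows like \<open>L(y) powr \<delta>\<close> as \<open>y\<close> tends to \<open>0\<close>. This is seen by duality,
  without solving the equation. As \<open>\<nabla>(L powr \<delta>) = - \<delta> c L powr \<delta>\<close>,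
  every radial \<open>\<Phi> = W L powr \<delta>\<close> satisfies
  \<open>\<nabla>\<Phi> + \<delta> c \<Phi> = L powr \<delta> \<nabla>W\<close>. Choose \<open>W\<close> with value \<open>0\<close> on the
  boundary so that the right-hand side is \<open>- x\<close>; its negative divergence is the constant \<open>n\<close>. Testing the equation
  \<open>- \<Delta>u + \<delta> c \<nabla>u = f\<close> with \<open>\<Phi>\<close> then gives
  \<open>n \<integral>u = \<integral>f \<Phi>\<close> (\<open>adjoint_solution_duality\<close>).
  Take for \<open>f\<close> the indicator of a small ball around \<open>0\<close>. There \<open>\<Phi>\<close> exceeds any given number
  (\<open>dual_weight_unbounded_at_0\<close>), whereas a bound \<open>g(y, x) \<le> C |y - x| powr (2 - n)\<close> and
  Tonelli bound \<open>\<integral>u\<close> by a fixed multiple of \<open>\<integral>f\<close>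
  (\<open>integral_kernel_average_le\<close>): a contradiction (\<open>green_function_not_bounded\<close>).

  \<open>\<Phi>\<close> is neither smooth at \<open>0\<close> nor compactly supported in the ball, so it is replaced by
  smooth radial test functions \<open>F\<^sub>m(x \<bullet> x)\<close> that cut off small values of \<open>t\<close> and of
  \<open>W\<close> (\<open>radial_approx_test_function\<close>). In both cases the derivative of the cut-off is, up to a
  bounded factor that tends to zero, the reciprocal of the quantity that is cut off. Therefore
  the vector fields \<open>\<nabla>\<Phi>\<^sub>m + \<delta> c \<Phi>\<^sub>m\<close> converge to \<open>- x\<close>
  pointwise under a majorant \<open>K r powr (- 5/4)\<close>, which is square integrable for \<open>n \<ge> 3\<close>.
\<close>

section \<open>Radial powers and Lebesgue integration on subsets\<close>

definition log_drift :: "'a::real_inner \<Rightarrow> 'a" where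
  "log_drift x = - ((1 / ((norm x)\<^sup>2 * ln (norm x))) *\<^sub>R x)"

text \<open>Dyadic shells replace polar coordinates: on \<open>2 powr - (j + 1) \<le> |z| < 2 powr - j\<close> the integrand is at most
  \<open>A j = 2 powr (a (j + 1))\<close>, and the ball of radius \<open>2 powr - j\<close> has volume of order
  \<open>2 powr (- j DIM('a))\<close>, so that the shells contribute a convergent geometric series.\<close>
lemma nn_integral_norm_powr_unit_ball_finite:
  fixes a :: real
  assumes "0 \<le> a" "a < DIM('a::euclidean_space)"
  shows "(\<integral>\<^sup>+z\<in>ball (0::'a) 1. ennreal (norm z powr - a) \<partial>lborel) < \<infinity>"
proof -
  let ?n = "DIM('a)"
  define A where "A j = (2 powr a) ^ Suc j" for j :: nat
  have pt: "ennreal (norm z powr - a) * indicator (ball 0 1) z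
      \<le> (\<Sum>j. ennreal (A j) * indicator (ball 0 ((1 / 2) ^ j)) z)" for z :: 'a
  proof (cases "z \<in> ball 0 1 \<and> z \<noteq> 0")
    case True
    define j where "j = (LEAST j. (1 / 2) ^ Suc j \<le> norm z)"
    obtain i where i: "(1 / 2) ^ i < norm z"
      using True real_arch_pow_inv[of "norm z" "1 / 2"] by auto
    then have "(1 / 2) ^ Suc i \<le> norm z"
      using norm_ge_zero[of z] unfolding power_Suc by linarith
    then have j: "(1 / 2) ^ Suc j \<le> norm z"
      unfolding j_def by (rule LeastI)
    have zj: "norm z < (1 / 2) ^ j"
    proof (cases j)
      case (Suc l)
      then have "l < (LEAST j. (1 / 2) ^ Suc j \<le> norm z)" by (simp add: j_def)
      then have "\<not> (1 / 2) ^ Suc l \<le> norm z" by (rule not_less_Least)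
      then show ?thesis by (simp only: Suc not_le)
    qed (use True in auto)
    have "norm z powr - a \<le> ((1 / 2) ^ Suc j) powr - a"
      using j assms by (intro powr_mono2') auto
    also have "\<dots> = A j"
      unfolding A_def
      by (simp only: powr_realpow[symmetric] powr_powr powr_minus zero_less_divide_1_iff
          zero_less_numeral powr_gt_zero)
        (simp add: powr_powr powr_divide powr_minus divide_simps mult.commute powr_add)
    finally have "ennreal (norm z powr - a) * indicator (ball 0 1) z
        \<le> (\<Sum>i\<in>{j}. ennreal (A i) * indicator (ball 0 ((1 / 2) ^ i)) z)"
      using zj by (auto simp: indicator_def ennreal_leI)
    also have "\<dots> \<le> (\<Sum>j. ennreal (A j) * indicator (ball 0 ((1 / 2) ^ j)) z)"
      by (rule sum_le_suminf) auto
    finally show ?thesis .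
  qed auto
  have "(\<integral>\<^sup>+z\<in>ball (0::'a) 1. ennreal (norm z powr - a) \<partial>lborel)
      \<le> (\<integral>\<^sup>+z. (\<Sum>j. ennreal (A j) * indicator (ball 0 ((1 / 2) ^ j)) z) \<partial>(lborel :: 'a measure))"
    by (rule nn_integral_mono) (use pt in auto)
  also have "\<dots> = (\<Sum>j. ennreal (A j) * emeasure lborel (ball (0::'a) ((1 / 2) ^ j)))"
    by (subst nn_integral_suminf) (measurable, simp_all add: nn_integral_cmult_indicator)
  also have "\<dots> = (\<Sum>j. ennreal (2 powr a * unit_ball_vol ?n * (2 powr a / 2 ^ ?n) ^ j))"
    by (intro suminf_cong)
      (simp add: emeasure_ball A_def ennreal_mult[symmetric] power_divide power_mult[symmetric]
        mult.commute field_simps)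
  also have "\<dots> < \<infinity>"
  proof -
    have "(2::real) powr a / 2 ^ ?n < 1"
      using powr_less_mono[of a "real ?n" 2] assms by (simp add: powr_realpow)
    then have "summable (\<lambda>j. 2 powr a * unit_ball_vol ?n * (2 powr a / 2 ^ ?n) ^ j)"
      by (intro summable_mult summable_geometric) auto
    then show ?thesis
      using ennreal_suminf_neq_top by (auto simp: less_top)
  qed
  finally show ?thesis .
qed

text \<open>Translating by the pole moves the ball into the unit ball, which gives a bound uniform in the pole.\<close>
lemma nn_integral_norm_diff_powr_ball_le:
  fixes y :: "'a::euclidean_space" and a :: real
  assumes "norm y + r \<le> 1"
  shows "(\<integral>\<^sup>+x\<in>ball 0 r. ennreal (norm (y - x) powr - a) \<partial>lborel)
      \<le> (\<integral>\<^sup>+z\<in>ball (0::'a) 1. ennreal (norm z powr - a) \<partial>lborel)"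
proof -
  have "(\<integral>\<^sup>+z\<in>ball (0::'a) 1. ennreal (norm z powr - a) \<partial>lborel)
      = (\<integral>\<^sup>+z. ennreal (norm z powr - a) * indicator (ball 0 1) z \<partial>distr lborel borel ((+) (- y)))"
    by (simp add: lborel_distr_plus)
  also have "\<dots> = (\<integral>\<^sup>+x. ennreal (norm (x - y) powr - a) * indicator (ball 0 1) (x - y) \<partial>lborel)"
    by (subst nn_integral_distr) (measurable, simp_all)
  also have "\<dots> \<ge> (\<integral>\<^sup>+x\<in>ball 0 r. ennreal (norm (y - x) powr - a) \<partial>lborel)"
  proof (rule nn_integral_mono)
    fix x :: 'a
    have "norm (x - y) \<le> norm x + norm y" by (rule norm_triangle_ineq4)
    then show "ennreal (norm (y - x) powr - a) * indicator (ball 0 r) x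
        \<le> ennreal (norm (x - y) powr - a) * indicator (ball 0 1) (x - y)"
      using assms by (auto simp: indicator_def norm_minus_commute)
  qed
  finally show ?thesis .
qed

text \<open>The exponent \<open>1 / 4\<close> only has to be small: the majorants below then stay square integrable
  in dimension three.\<close>
lemma neg_ln_powr_le:
  fixes d r :: real
  assumes "d > 0" "0 < r" "r < 1"
  shows "(- ln r) powr d \<le> (4 * d) powr d * r powr (- (1 / 4))"
proof -
  define x where "x = r powr (- (1 / 4))"
  have x: "x > 1" using assms powr_less_mono2_neg[of "- (1 / 4)" r 1] by (simp add: x_def)
  have l: "- ln r = 4 * ln x" using assms by (simp add: x_def ln_powr)
  have "(- ln r) powr d = 4 powr d * (ln x) powr d"
    unfolding l using x by (simp add: powr_mult)
  also have "\<dots> \<le> 4 powr d * (d powr d * x)"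
    using x assms by (intro mult_left_mono ln_powr_bound2) auto
  also have "\<dots> = (4 * d) powr d * x" using assms by (simp add: powr_mult)
  finally show ?thesis by (simp add: x_def)
qed

lemma borel_measurable_lebesgue_onI:
  "f \<in> borel_measurable borel \<Longrightarrow> f \<in> borel_measurable (lebesgue_on S)"
  by (simp add: measurable_completion measurable_restrict_space1)

lemma borel_measurable_log_drift:
  "log_drift \<in> borel_measurable (lebesgue_on (S :: 'a::euclidean_space set))"
  unfolding log_drift_def[abs_def] by (intro borel_measurable_lebesgue_onI) measurable

lemma nn_integral_lebesgue_on:
  assumes "S \<in> sets lebesgue"
  shows "(\<integral>\<^sup>+x. f x \<partial>lebesgue_on S) = (\<integral>\<^sup>+x\<in>S. f x \<partial>lborel)"
  using assms by (simp add: nn_integral_restrict_space nn_integral_completion)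

text \<open>It holds for every \<open>f\<close> because the Bochner integral of a non-integrable function is zero.\<close>
lemma ennreal_integral_le_nn_integral:
  "ennreal (\<integral>x. f x \<partial>M) \<le> (\<integral>\<^sup>+x. ennreal (f x) \<partial>M)"
proof (cases "integrable M f")
  case True
  have "ennreal (\<integral>x. f x \<partial>M) \<le> ennreal (\<integral>x. max 0 (f x) \<partial>M)"
    using True by (intro ennreal_leI integral_mono) auto
  also have "\<dots> = (\<integral>\<^sup>+x. ennreal (max 0 (f x)) \<partial>M)"
    using True by (intro nn_integral_eq_integral[symmetric]) auto
  also have "\<dots> = (\<integral>\<^sup>+x. ennreal (f x) \<partial>M)"
    by (intro nn_integral_cong) (auto simp: max_def ennreal_neg)
  finally show ?thesis .
qed (simp add: not_integrable_integral_eq)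

lemma integral_lebesgue_on_eq_lborel:
  fixes f :: "'a::euclidean_space \<Rightarrow> 'b::euclidean_space"
  assumes "S \<in> sets lebesgue" "f \<in> borel_measurable borel" "\<And>x. x \<notin> S \<Longrightarrow> f x = 0"
  shows "(\<integral>x. f x \<partial>lebesgue_on S) = (\<integral>x. f x \<partial>lborel)"
proof -
  have "(\<integral>x. f x \<partial>lebesgue_on S) = (\<integral>x. indicator S x *\<^sub>R f x \<partial>lebesgue)"
    using assms by (intro integral_restrict_space) auto
  also have "\<dots> = (\<integral>x. f x \<partial>lebesgue)"
    by (intro Bochner_Integration.integral_cong) (auto simp: indicator_def assms(3))
  finally show ?thesis using assms(2) by (simp add: integral_completion)
qed

lemma (in finite_measure) integrable_norm_if_square_integrable:
  fixes f :: "'a \<Rightarrow> 'b::euclidean_space"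
  assumes "f \<in> borel_measurable M" "integrable M (\<lambda>x. (norm (f x))\<^sup>2)"
  shows "integrable M f"
proof (rule Bochner_Integration.integrable_bound)
  show "integrable M (\<lambda>x. 1 + (norm (f x))\<^sup>2)" using assms by auto
  have "s \<le> 1 + s\<^sup>2" for s :: real
    using zero_le_power2[of "s - 1 / 2"] by (simp add: power2_eq_square algebra_simps)
  then show "AE x in M. norm (f x) \<le> norm (1 + (norm (f x))\<^sup>2)"
    by (intro AE_I2) (simp add: abs_of_nonneg add_nonneg_nonneg)
qed (use assms in auto)

text \<open>Instead of the Cauchy--Schwarz inequality for integrals, the pointwise inequality
  \<open>s \<le> (a + s\<^sup>2 / a) / 2\<close> is integrated with a suitable \<open>a\<close>.\<close>
lemma (in finite_measure) integral_inner_tendsto_if_L2_tendsto: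
  fixes f :: "'a \<Rightarrow> 'b::euclidean_space" and F :: "nat \<Rightarrow> 'a \<Rightarrow> 'b"
  assumes meas: "f \<in> borel_measurable M" "\<And>k. F k \<in> borel_measurable M"
      "h \<in> borel_measurable M"
    and sq: "integrable M (\<lambda>x. (norm (f x))\<^sup>2)" "\<And>k. integrable M (\<lambda>x. (norm (F k x))\<^sup>2)"
    and h: "\<And>x. x \<in> space M \<Longrightarrow> norm (h x) \<le> 1"
    and lim: "(\<lambda>k. \<integral>x. (norm (F k x - f x))\<^sup>2 \<partial>M) \<longlonglongrightarrow> 0"
  shows "(\<lambda>k. \<integral>x. F k x \<bullet> h x \<partial>M) \<longlonglongrightarrow> (\<integral>x. f x \<bullet> h x \<partial>M)"
proof (rule LIMSEQ_I)
  fix e :: real assume e: "e > 0"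
  note [measurable] = meas
  define \<mu> where "\<mu> = measure M (space M)"
  \<comment> \<open>makes \<open>a \<mu> < e\<close>, while the \<open>L\<^sup>2\<close> term is below \<open>e a\<close> eventually\<close>
  define a where "a = e / (\<mu> + 1)"
  have \<mu>: "\<mu> \<ge> 0" by (simp add: \<mu>_def)
  then have a: "a > 0" "a * \<mu> < e" using e by (auto simp: a_def field_simps)
  have int: "integrable M f" "integrable M (F k)" for k
    by (rule integrable_norm_if_square_integrable, fact, fact)+
  have inth: "integrable M (\<lambda>x. g x \<bullet> h x)" if "integrable M g" for g
  proof (rule Bochner_Integration.integrable_bound[OF integrable_norm[OF that]])
    have [measurable]: "g \<in> borel_measurable M" using that by simp
    show "(\<lambda>x. g x \<bullet> h x) \<in> borel_measurable M" by simp
    show "AE x in M. norm (g x \<bullet> h x) \<le> norm (norm (g x))"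
    proof (rule AE_I2)
      fix x assume "x \<in> space M"
      then have "norm (g x) * norm (h x) \<le> norm (g x) * 1"
        using h by (intro mult_left_mono) auto
      then show "norm (g x \<bullet> h x) \<le> norm (norm (g x))"
        using Cauchy_Schwarz_ineq2[of "g x" "h x"] by simp
    qed
  qed
  have sqd: "integrable M (\<lambda>x. (norm (F k x - f x))\<^sup>2)" for k
  proof (rule Bochner_Integration.integrable_bound)
    show "integrable M (\<lambda>x. 2 * (norm (F k x))\<^sup>2 + 2 * (norm (f x))\<^sup>2)" using sq by auto
    have "(norm (u - v))\<^sup>2 \<le> 2 * (norm u)\<^sup>2 + 2 * (norm v)\<^sup>2" for u v :: 'b
      using zero_le_power2[of "norm (u + v)"]
      by (simp add: power2_norm_eq_inner inner_commute algebra_simps)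
    then show "AE x in M. norm ((norm (F k x - f x))\<^sup>2)
        \<le> norm (2 * (norm (F k x))\<^sup>2 + 2 * (norm (f x))\<^sup>2)"
      by (intro AE_I2) simp
  qed simp
  obtain N where N: "\<And>k. k \<ge> N \<Longrightarrow> norm ((\<integral>x. (norm (F k x - f x))\<^sup>2 \<partial>M) - 0) < e * a"
    using LIMSEQ_D[OF lim, of "e * a"] e a by auto
  show "\<exists>N. \<forall>k\<ge>N. norm ((\<integral>x. F k x \<bullet> h x \<partial>M) - (\<integral>x. f x \<bullet> h x \<partial>M)) < e"
  proof (intro exI allI impI)
    fix k assume k: "k \<ge> N"
    have "(\<integral>x. F k x \<bullet> h x \<partial>M) - (\<integral>x. f x \<bullet> h x \<partial>M) = (\<integral>x. (F k x - f x) \<bullet> h x \<partial>M)"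
      using inth int by (simp add: inner_diff_left)
    also have "norm \<dots> \<le> (\<integral>x. (a + (norm (F k x - f x))\<^sup>2 / a) / 2 \<partial>M)"
    proof (rule order_trans[OF integral_norm_bound integral_mono])
      show "integrable M (\<lambda>x. norm ((F k x - f x) \<bullet> h x))"
        using inth[OF Bochner_Integration.integrable_diff[OF int(2) int(1)]] by (rule integrable_norm)
      show "integrable M (\<lambda>x. (a + (norm (F k x - f x))\<^sup>2 / a) / 2)"
        using sqd by auto
      fix x assume "x \<in> space M"
      then have "norm ((F k x - f x) \<bullet> h x) \<le> norm (F k x - f x)"
        using Cauchy_Schwarz_ineq2[of "F k x - f x" "h x"] h
          mult_left_mono[of "norm (h x)" 1 "norm (F k x - f x)"] by auto
      also have "s \<le> (a + s\<^sup>2 / a) / 2" for s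
        using zero_le_power2[of "s - a"] a(1) by (simp add: power2_eq_square field_simps)
      finally show "norm ((F k x - f x) \<bullet> h x) \<le> (a + (norm (F k x - f x))\<^sup>2 / a) / 2" .
    qed
    also have "\<dots> = (a * \<mu> + (\<integral>x. (norm (F k x - f x))\<^sup>2 \<partial>M) / a) / 2"
      using sqd by (simp add: \<mu>_def)
    also have "\<dots> < e"
    proof -
      have "(\<integral>x. (norm (F k x - f x))\<^sup>2 \<partial>M) / a < e"
        using N[OF k] a(1) by (simp add: field_simps)
      then show ?thesis using a(2) by simp
    qed
    finally show "norm ((\<integral>x. F k x \<bullet> h x \<partial>M) - (\<integral>x. f x \<bullet> h x \<partial>M)) < e" .
  qed
qed

lemma integrable_norm_powr_lebesgue_on:
  fixes S :: "'a::euclidean_space set" and a :: real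
  assumes "0 \<le> a" "a < DIM('a)" "S \<in> sets lebesgue" "S \<subseteq> ball 0 1"
  shows "integrable (lebesgue_on S) (\<lambda>x. norm x powr - a)"
proof (rule integrableI_bounded)
  show "(\<lambda>x. norm x powr - a) \<in> borel_measurable (lebesgue_on S)"
    by (intro borel_measurable_lebesgue_onI) measurable
  have "(\<integral>\<^sup>+x. ennreal (norm (norm x powr - a)) \<partial>lebesgue_on S)
      \<le> (\<integral>\<^sup>+z\<in>ball (0::'a) 1. ennreal (norm z powr - a) \<partial>lborel)"
    unfolding nn_integral_lebesgue_on[OF assms(3)]
    by (intro nn_integral_mono) (use assms(4) in \<open>auto simp: indicator_def\<close>)
  also have "\<dots> < \<infinity>" by (rule nn_integral_norm_powr_unit_ball_finite[OF assms(1,2)])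
  finally show "(\<integral>\<^sup>+x. ennreal (norm (norm x powr - a)) \<partial>lebesgue_on S) < \<infinity>" .
qed

section \<open>The Lorentz norm of the drift\<close>

lemma enn_powr_mono: "x \<le> y \<Longrightarrow> p \<ge> 0 \<Longrightarrow> enn_powr x p \<le> enn_powr y p"
  by (auto simp: enn_powr_def top_unique less_top intro!: ennreal_leI powr_mono2 enn2real_mono)

lemma enn_powr_mult:
  assumes "d > 0"
  shows "enn_powr (ennreal d * x) p = ennreal (d powr p) * enn_powr x p"
  using assms
  by (auto simp: enn_powr_def ennreal_mult_eq_top_iff enn2real_mult powr_mult ennreal_mult
      ennreal_top_mult ennreal_mult_top)

text \<open>For non-measurable \<open>f\<close> as well, so that no measurability of the rearrangement has to be shown: division by \<open>d\<close> maps the simple functions below \<open>d f\<close> to simple functions below \<open>f\<close>.\<close>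
lemma nn_integral_cmult_le:
  assumes "d > 0"
  shows "(\<integral>\<^sup>+x. ennreal d * f x \<partial>M) \<le> ennreal d * (\<integral>\<^sup>+x. f x \<partial>M)"
  unfolding nn_integral_def[of M "\<lambda>x. ennreal d * f x"]
proof (rule SUP_least, clarify)
  fix g assume g: "simple_function M g" "g \<le> (\<lambda>x. ennreal d * f x)"
  define h where "h x = ennreal (1 / d) * g x" for x
  have h: "simple_function M h" using g(1) by (simp add: h_def[abs_def])
  have dd: "ennreal d * (ennreal (1 / d) * y) = y" "ennreal (1 / d) * (ennreal d * y) = y" for y
    using assms by (simp_all add: mult.assoc[symmetric] ennreal_mult[symmetric])
  have "h x \<le> f x" for x
    using mult_left_mono[OF le_funD[OF g(2), of x], of "ennreal (1 / d)"] dd by (simp add: h_def)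
  then have le: "(\<integral>\<^sup>+x. h x \<partial>M) \<le> (\<integral>\<^sup>+x. f x \<partial>M)" by (intro nn_integral_mono) auto
  have "integral\<^sup>S M g = (\<integral>\<^sup>+x. ennreal d * h x \<partial>M)"
    using g(1) by (simp add: nn_integral_eq_simple_integral[symmetric] h_def dd)
  also have "\<dots> = ennreal d * (\<integral>\<^sup>+x. h x \<partial>M)"
    using h by (intro nn_integral_cmult borel_measurable_simple_function)
  also have "\<dots> \<le> ennreal d * (\<integral>\<^sup>+x. f x \<partial>M)" using le by (rule mult_left_mono) simp
  finally show "integral\<^sup>S M g \<le> ennreal d * (\<integral>\<^sup>+x. f x \<partial>M)" .
qed

lemma decr_rearr_scaleR_le:
  assumes "d > 0"
  shows "decr_rearr \<Omega> (\<lambda>x. d *\<^sub>R f x) s \<le> ennreal d * decr_rearr \<Omega> f s"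
proof -
  let ?X = "decr_rearr \<Omega> (\<lambda>x. d *\<^sub>R f x) s"
  have "?X / ennreal d \<le> decr_rearr \<Omega> f s"
    unfolding decr_rearr_def[of \<Omega> f]
  proof (rule Inf_greatest, clarify)
    fix t :: real
    assume t: "t > 0" "emeasure lebesgue {x \<in> \<Omega>. norm (f x) > t} \<le> ennreal s"
    have "{x \<in> \<Omega>. norm (d *\<^sub>R f x) > d * t} = {x \<in> \<Omega>. norm (f x) > t}"
      using assms by auto
    then have "?X \<le> ennreal (d * t)"
      unfolding decr_rearr_def using t assms by (intro Inf_lower) (auto intro!: exI[of _ "d * t"])
    then show "?X / ennreal d \<le> ennreal t"
      using assms t by (intro divide_le_posI_ennreal) (auto simp: ennreal_mult)
  qed
  then have "ennreal d * (?X / ennreal d) \<le> ennreal d * decr_rearr \<Omega> f s"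
    by (rule mult_left_mono) simp
  moreover have "ennreal d * (?X / ennreal d) = ?X"
    using assms by (simp add: ennreal_times_divide mult.commute[of "ennreal d"] mult_divide_eq_ennreal)
  ultimately show ?thesis by simp
qed

lemma lorentz_norm_scaleR_le:
  assumes d: "d > 0" and q: "q > 0"
  shows "lorentz_norm p q \<Omega> (\<lambda>x. d *\<^sub>R f x) \<le> ennreal d * lorentz_norm p q \<Omega> f"
proof -
  let ?w = "\<lambda>g t. ennreal (t powr (1 / p)) * decr_rearr \<Omega> g t"
  have w: "?w (\<lambda>x. d *\<^sub>R f x) t \<le> ennreal d * ?w f t" for t
    using mult_left_mono[OF decr_rearr_scaleR_le[OF d, of \<Omega> f t], of "ennreal (t powr (1 / p))"]
    by (simp add: mult_ac)
  show ?thesis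
  proof (cases "q = top")
    case True
    have "(SUP t\<in>{0<..}. ?w (\<lambda>x. d *\<^sub>R f x) t) \<le> ennreal d * (SUP t\<in>{0<..}. ?w f t)"
      by (rule SUP_least, rule order_trans[OF w]) (auto intro!: mult_left_mono SUP_upper)
    then show ?thesis using True by (simp add: lorentz_norm_def)
  next
    case False
    define r where "r = enn2real q"
    have r: "r > 0" using q False by (simp add: r_def enn2real_positive_iff less_top)
    let ?I = "\<lambda>g. \<integral>\<^sup>+t\<in>{0<..}. enn_powr (?w g t) r * ennreal (1 / t) \<partial>lborel"
    have "?I (\<lambda>x. d *\<^sub>R f x)
        \<le> (\<integral>\<^sup>+t. ennreal (d powr r) * (enn_powr (?w f t) r * ennreal (1 / t) * indicator {0<..} t) \<partial>lborel)"
    proof (rule nn_integral_mono)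
      fix t
      have "enn_powr (?w (\<lambda>x. d *\<^sub>R f x) t) r \<le> ennreal (d powr r) * enn_powr (?w f t) r"
        using enn_powr_mono[OF w, of r t] r by (simp add: enn_powr_mult[OF d])
      then show "enn_powr (?w (\<lambda>x. d *\<^sub>R f x) t) r * ennreal (1 / t) * indicator {0<..} t
          \<le> ennreal (d powr r) * (enn_powr (?w f t) r * ennreal (1 / t) * indicator {0<..} t)"
        unfolding mult.assoc[symmetric] by (intro mult_right_mono) auto
    qed
    also have "\<dots> \<le> ennreal (d powr r) * ?I f"
      using d by (intro nn_integral_cmult_le) simp
    finally have "enn_powr (?I (\<lambda>x. d *\<^sub>R f x)) (1 / r) \<le> enn_powr (ennreal (d powr r) * ?I f) (1 / r)"
      using r by (intro enn_powr_mono) auto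
    also have "\<dots> = ennreal d * enn_powr (?I f) (1 / r)"
      using d r by (subst enn_powr_mult) (auto simp: powr_powr)
    finally show ?thesis using False by (simp add: lorentz_norm_def r_def)
  qed
qed

lemma norm_log_drift:
  assumes "0 < norm x" "norm x < 1"
  shows "norm (log_drift x) = 1 / (norm x * - ln (norm x))"
proof -
  have "ln (norm x) < 0" using assms by simp
  then show ?thesis
    using assms by (simp add: log_drift_def abs_mult power2_eq_square divide_simps)
qed

text \<open>The derivative \<open>- ln y - 1\<close> is nonnegative exactly up to \<open>1 / e\<close>, the radius of the ball on which the drift is considered.\<close>
lemma mult_neg_ln_mono:
  fixes r s :: real
  assumes "0 < r" "r \<le> s" "s \<le> 1 / exp 1"
  shows "r * - ln r \<le> s * - ln s"
proof (rule DERIV_nonneg_imp_nondecreasing[OF assms(2)])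
  fix y assume y: "r \<le> y" "y \<le> s"
  have "y > 0" using y assms by simp
  have "((\<lambda>y. y * - ln y) has_real_derivative (- ln y - 1)) (at y)"
    using \<open>y > 0\<close> by (auto intro!: derivative_eq_intros)
  moreover have "ln y \<le> ln (1 / exp 1)"
    using y assms by (subst ln_le_cancel_iff) auto
  then have "0 \<le> - ln y - 1" by (simp add: ln_div)
  ultimately show "\<exists>z. ((\<lambda>y. y * - ln y) has_real_derivative z) (at y) \<and> 0 \<le> z" by blast
qed

text \<open>Let \<open>r\<close> be the radius of the ball of measure \<open>s\<close>. Since \<open>norm (log_drift x)\<close> decreases in
  \<open>|x|\<close>, its superlevel set at the value \<open>1 / (r L)\<close> taken on the sphere of radius \<open>r\<close> is contained in that
  ball; here \<open>L = - ln r = (ln \<omega> - ln s) / n\<close>. Once the ball contains the whole domain,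
  every positive level is admissible and the rearrangement vanishes.\<close>
lemma weighted_decr_rearr_log_drift_le:
  fixes s :: real
  defines "B \<equiv> ball (0::'a::euclidean_space) (1 / exp 1)" and "n \<equiv> real DIM('a)"
  defines "\<omega> \<equiv> unit_ball_vol n"
  assumes s: "s > 0"
  shows "ennreal (s powr (1 / n)) * decr_rearr B (log_drift :: 'a \<Rightarrow> 'a) s
    \<le> (if s < \<omega> * exp (- n) then ennreal (\<omega> powr (1 / n) / ((ln \<omega> - ln s) / n)) else 0)"
proof -
  have n: "n > 0" by (simp add: n_def)
  have \<omega>: "\<omega> > 0" using n by (simp add: \<omega>_def)
  define r where "r = (s / \<omega>) powr (1 / n)"
  have r: "r > 0" using s \<omega> by (simp add: r_def)
  have lnr: "- ln r = (ln \<omega> - ln s) / n"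
    using s \<omega> n by (simp add: r_def ln_powr ln_div field_simps)
  have rn: "\<omega> * r ^ DIM('a) = s"
    using s \<omega> n r by (simp add: r_def n_def powr_realpow[symmetric] powr_powr)
  have sr: "s powr (1 / n) = \<omega> powr (1 / n) * r"
    using s \<omega> by (simp add: r_def powr_divide)
  have ball: "emeasure lebesgue (ball (0::'a) r) = ennreal s"
    using r by (simp add: emeasure_ball rn[unfolded \<omega>_def n_def])
  have small: "emeasure lebesgue {x \<in> B. norm (log_drift x) > t} \<le> ennreal s"
    if "{x \<in> B. norm (log_drift x) > t} \<subseteq> ball 0 r" for t
    using emeasure_mono[OF that, of lebesgue] ball by simp
  have iff: "s < \<omega> * exp (- n) \<longleftrightarrow> r < 1 / exp 1"
  proof -
    have "s < \<omega> * exp (- n) \<longleftrightarrow> s / \<omega> < exp (- n)" using \<omega> by (simp add: field_simps)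
    also have "\<dots> \<longleftrightarrow> ln (s / \<omega>) < ln (exp (- n))"
      using s \<omega> by (intro ln_less_cancel_iff[symmetric]) auto
    also have "\<dots> \<longleftrightarrow> ln r < ln (1 / exp 1)"
      using s \<omega> n by (simp add: r_def ln_powr ln_div field_simps)
    also have "\<dots> \<longleftrightarrow> r < 1 / exp 1" using r by (intro ln_less_cancel_iff) auto
    finally show ?thesis .
  qed
  show ?thesis
  proof (cases "s < \<omega> * exp (- n)")
    case True
    then have r1: "r < 1 / exp 1" using iff by simp
    have l: "- ln r > 1"
    proof -
      have "ln r < ln (1 / exp 1)" using r r1 by (subst ln_less_cancel_iff) auto
      then show ?thesis by (simp add: ln_div)
    qed
    let ?t = "1 / (r * - ln r)"
    have t: "?t > 0" by (intro divide_pos_pos mult_pos_pos) (use r l in linarith)+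
    have "{x \<in> B. norm (log_drift x) > ?t} \<subseteq> ball 0 r"
    proof (rule subsetI, rule ccontr)
      fix x :: 'a assume x: "x \<in> {x \<in> B. norm (log_drift x) > ?t}" "x \<notin> ball 0 r"
      then have nx: "r \<le> norm x" "norm x < 1 / exp 1" by (auto simp: B_def)
      have "norm x < 1" using nx(2) by (rule less_le_trans) simp
      then have "norm (log_drift x) = 1 / (norm x * - ln (norm x))"
        using nx r by (intro norm_log_drift) auto
      also have "\<dots> \<le> ?t"
        using mult_neg_ln_mono[OF r nx(1)] nx r l \<open>norm x < 1\<close>
        by (intro frac_le mult_pos_pos) auto
      finally show False using x(1) by auto
    qed
    then have "decr_rearr B (log_drift :: 'a \<Rightarrow> 'a) s \<le> ennreal ?t"
      unfolding decr_rearr_def using small t by (intro Inf_lower) blast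
    then have "ennreal (s powr (1 / n)) * decr_rearr B (log_drift :: 'a \<Rightarrow> 'a) s
        \<le> ennreal (s powr (1 / n)) * ennreal ?t" by (rule mult_left_mono) simp
    also have "\<dots> = ennreal (s powr (1 / n) * ?t)"
      using t by (intro ennreal_mult[symmetric]) auto
    also have "s powr (1 / n) * ?t = \<omega> powr (1 / n) / ((ln \<omega> - ln s) / n)"
      unfolding sr lnr[symmetric] using r by simp
    finally show ?thesis using True by simp
  next
    case False
    then have r1: "1 / exp 1 \<le> r" using iff by simp
    have "decr_rearr B (log_drift :: 'a \<Rightarrow> 'a) s \<le> 0 + ennreal t" if "t > 0" for t
    proof -
      have "{x \<in> B. norm (log_drift x) > t} \<subseteq> ball 0 r" using r1 by (auto simp: B_def)
      then show ?thesis
        unfolding decr_rearr_def using small that by (simp, intro Inf_lower) blast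
    qed
    then have "decr_rearr B (log_drift :: 'a \<Rightarrow> 'a) s \<le> 0" by (rule ennreal_le_epsilon)
    then show ?thesis using False by simp
  qed
qed

text \<open>With \<open>l = (ln \<omega> - ln s) / n\<close>, the integrand is the derivative of
  \<open>n / (p - 1) * l powr (1 - p)\<close>, which tends to zero at the origin because \<open>p > 1\<close>.\<close>
lemma nn_integral_log_powr_finite:
  fixes p n \<omega> :: real
  assumes p: "p > 1" and n: "n > 0" and \<omega>: "\<omega> > 0"
  shows "(\<integral>\<^sup>+s\<in>{0<..<\<omega> * exp (- n)}. ennreal (((ln \<omega> - ln s) / n) powr - p / s) \<partial>lborel) < \<infinity>"
proof -
  let ?l = "\<lambda>s. (ln \<omega> - ln s) / n" and ?S = "\<omega> * exp (- n)"
  let ?F = "\<lambda>s. n / (p - 1) * ?l s powr (1 - p)" and ?f = "\<lambda>s. ?l s powr - p / s"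
  have l: "?l s > 1" if "0 < s" "s < ?S" for s
  proof -
    have "ln s < ln ?S" using that \<omega> by (subst ln_less_cancel_iff) auto
    then have "ln s < ln \<omega> - n" using \<omega> by (simp add: ln_mult)
    then show ?thesis using n by (simp add: field_simps)
  qed
  have "set_integrable lborel (einterval (ereal 0) (ereal ?S)) ?f"
  proof (rule interval_integral_FTC_nonneg(1)[where F = ?F and A = 0 and B = "n / (p - 1)"])
    show "ereal 0 < ereal ?S" using \<omega> by simp
    fix s :: real assume "ereal 0 < ereal s" "ereal s < ereal ?S"
    then have s: "0 < s" "s < ?S" by auto
    have l': "?l s > 0" using l[OF s] by simp
    have "(?F has_real_derivative n / (p - 1) * ((1 - p) * ?l s powr (1 - p - 1) * (- (1 / s) / n))) (at s)"
      using s l' n p by (auto intro!: derivative_eq_intros)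
    also have "n / (p - 1) * ((1 - p) * ?l s powr (1 - p - 1) * (- (1 / s) / n)) = ?f s"
      using p n s by (simp add: field_simps)
    finally show "(?F has_real_derivative ?f s) (at s)" .
    show "isCont ?f s" using s l' n by (intro continuous_intros) auto
  next
    show "AE x in lborel. ereal 0 < ereal x \<longrightarrow> ereal x < ereal ?S \<longrightarrow> 0 \<le> ?f x" by simp
    have "((\<lambda>s. ?F s) \<longlongrightarrow> 0) (at_right 0)"
      using p n by real_asymp
    then show "((?F \<circ> real_of_ereal) \<longlongrightarrow> 0) (at_right (ereal 0))"
      by (simp add: ereal_tendsto_simps)
    have "isCont ?F ?S" using \<omega> n by (intro continuous_intros) (auto simp: ln_mult)
    then have "(?F \<longlongrightarrow> ?F ?S) (at_left ?S)"
      by (simp add: isCont_def filterlim_at_split)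
    moreover have "?F ?S = n / (p - 1)" using \<omega> n by (simp add: ln_mult)
    ultimately have "(?F \<longlongrightarrow> n / (p - 1)) (at_left ?S)" by (simp only:)
    then show "((?F \<circ> real_of_ereal) \<longlongrightarrow> n / (p - 1)) (at_left (ereal ?S))"
      by (simp add: ereal_tendsto_simps)
  qed
  then have "integrable lborel (\<lambda>s. indicator {0<..<?S} s *\<^sub>R ?f s)"
    by (simp add: set_integrable_def einterval_eq)
  then have "(\<integral>\<^sup>+s. ennreal (norm (indicator {0<..<?S} s *\<^sub>R ?f s)) \<partial>lborel) < \<infinity>"
    by (simp add: integrable_iff_bounded)
  also have "(\<integral>\<^sup>+s. ennreal (norm (indicator {0<..<?S} s *\<^sub>R ?f s)) \<partial>lborel)
      = (\<integral>\<^sup>+s\<in>{0<..<?S}. ennreal (?f s) \<partial>lborel)"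
    by (intro nn_integral_cong) (auto simp: indicator_def)
  finally show ?thesis .
qed

lemma lorentz_norm_log_drift_finite:
  assumes q: "q > 1"
  shows "lorentz_norm (real DIM('a)) q (ball (0::'a::euclidean_space) (1 / exp 1)) (log_drift :: 'a \<Rightarrow> 'a) < top"
proof -
  define n where "n = real DIM('a)"
  define \<omega> where "\<omega> = unit_ball_vol n"
  have n: "n > 0" by (simp add: n_def)
  have \<omega>: "\<omega> > 0" using n by (simp add: \<omega>_def)
  define A where "A = \<omega> powr (1 / n)"
  let ?l = "\<lambda>s. (ln \<omega> - ln s) / n" and ?S = "\<omega> * exp (- n)"
  let ?w = "\<lambda>s. ennreal (s powr (1 / n)) *
    decr_rearr (ball (0::'a) (1 / exp 1)) (log_drift :: 'a \<Rightarrow> 'a) s"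
  have w: "?w s \<le> (if s < ?S then ennreal (A / ?l s) else 0)" if "s > 0" for s
    using weighted_decr_rearr_log_drift_le[where 'a = 'a, OF that] unfolding n_def \<omega>_def A_def .
  have l: "?l s > 1" if "0 < s" "s < ?S" for s
  proof -
    have "ln s < ln ?S" using that \<omega> by (subst ln_less_cancel_iff) auto
    then have "ln s < ln \<omega> - n" using \<omega> by (simp add: ln_mult)
    then show ?thesis using n by (simp add: field_simps)
  qed
  have A: "A > 0" using \<omega> by (simp add: A_def)
  show ?thesis
  proof (cases "q = top")
    case True
    have "(SUP s\<in>{0<..}. ?w s) \<le> ennreal A"
    proof (rule SUP_least)
      fix s :: real assume "s \<in> {0<..}"
      then have s: "s > 0" by simp
      have "A / ?l s \<le> A" if "s < ?S"
        using divide_left_mono[of 1 "?l s" A] l[OF s that] A by simp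
      then show "?w s \<le> ennreal A"
        using w[OF s] by (auto split: if_splits intro: order_trans ennreal_leI)
    qed
    also have "\<dots> < top" by simp
    finally show ?thesis using True by (simp add: lorentz_norm_def n_def)
  next
    case False
    define p where "p = enn2real q"
    have p: "p > 1" using q False by (cases q) (auto simp: p_def)
    have powr_quot: "enn_powr (ennreal (A / L)) p = ennreal (A powr p * L powr - p)" if "L > 1" for L
      using A that by (simp add: enn_powr_def powr_divide powr_minus_divide)
    let ?I = "\<integral>\<^sup>+s\<in>{0<..}. enn_powr (?w s) p * ennreal (1 / s) \<partial>lborel"
    have "?I \<le> (\<integral>\<^sup>+s. ennreal (A powr p) * (ennreal (?l s powr - p / s) * indicator {0<..<?S} s) \<partial>lborel)"
    proof (rule nn_integral_mono)
      fix s :: real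
      show "enn_powr (?w s) p * ennreal (1 / s) * indicator {0<..} s
          \<le> ennreal (A powr p) * (ennreal (?l s powr - p / s) * indicator {0<..<?S} s)"
      proof (cases "s > 0")
        case s: True
        show ?thesis
        proof (cases "s < ?S")
          case True
          have "enn_powr (?w s) p \<le> enn_powr (ennreal (A / ?l s)) p"
            using w[OF s] True p by (intro enn_powr_mono) auto
          also have "\<dots> = ennreal (A powr p * ?l s powr - p)"
            by (rule powr_quot) (rule l[OF s True])
          finally have "enn_powr (?w s) p * ennreal (1 / s)
              \<le> ennreal (A powr p * ?l s powr - p) * ennreal (1 / s)" by (rule mult_right_mono) simp
          also have "\<dots> = ennreal (A powr p) * ennreal (?l s powr - p / s)"
            using s by (simp add: ennreal_mult[symmetric])
          finally show ?thesis using s True by simp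
        next
          case False
          then have w0: "?w s = 0" using w[OF s] by simp
          have "enn_powr (?w s) p = 0" unfolding w0 by (simp add: enn_powr_def)
          then show ?thesis by (simp only: mult_zero_left zero_le)
        qed
      qed simp
    qed
    also have "\<dots> \<le> ennreal (A powr p) *
        (\<integral>\<^sup>+s\<in>{0<..<?S}. ennreal (?l s powr - p / s) \<partial>lborel)"
      using A by (intro nn_integral_cmult_le) simp
    also have "\<dots> < top"
      using nn_integral_log_powr_finite[OF p n \<omega>] by (simp add: ennreal_mult_less_top)
    finally have "?I < top" .
    then show ?thesis using False by (simp add: lorentz_norm_def n_def p_def enn_powr_def)
  qed
qed

section \<open>Smooth functions of one real variable\<close>

text \<open>Derivatives are witnessed existentially rather than by \<open>deriv\<close>: closure under the
  algebraic operations is then a plain induction, and only the gluing of two open sets needs uniqueness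
  of the derivative.\<close>
primrec Cn_on :: "nat \<Rightarrow> real set \<Rightarrow> (real \<Rightarrow> real) \<Rightarrow> bool" where
  "Cn_on 0 S f \<longleftrightarrow> continuous_on S f"
| "Cn_on (Suc k) S f \<longleftrightarrow>
     (\<exists>f'. (\<forall>x\<in>S. (f has_real_derivative f' x) (at x)) \<and> Cn_on k S f')"

lemma Cn_on_imp_continuous_on: "Cn_on k S f \<Longrightarrow> continuous_on S f"
  by (cases k) (auto intro!: continuous_at_imp_continuous_on dest: DERIV_isCont)

lemma Cn_on_SucD: "Cn_on (Suc k) S f \<Longrightarrow> Cn_on k S f"
proof (induction k arbitrary: f)
  case 0
  then show ?case using Cn_on_imp_continuous_on[of "Suc 0" S f] by simp
next
  case (Suc k)
  then obtain f' where "\<forall>x\<in>S. (f has_real_derivative f' x) (at x)" "Cn_on (Suc k) S f'"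
    unfolding Cn_on.simps(2)[of "Suc k"] by blast
  then show ?case using Suc.IH[of f'] by auto
qed

lemma Cn_on_subset: "Cn_on k S f \<Longrightarrow> T \<subseteq> S \<Longrightarrow> Cn_on k T f"
proof (induction k arbitrary: f)
  case 0
  then show ?case by (auto intro: continuous_on_subset)
next
  case (Suc k)
  then obtain f' where "\<forall>x\<in>S. (f has_real_derivative f' x) (at x)" "Cn_on k S f'"
    by auto
  then show ?case using Suc.IH[of f'] Suc.prems(2) by auto
qed

lemma Cn_on_cong:
  assumes "open S" "Cn_on k S f" "\<And>x. x \<in> S \<Longrightarrow> f x = g x"
  shows "Cn_on k S g"
proof (cases k)
  case 0
  then show ?thesis using assms continuous_on_cong[of S S f g] by simp
next
  case (Suc j)
  then obtain f' where f': "\<forall>x\<in>S. (f has_real_derivative f' x) (at x)" "Cn_on j S f'"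
    using assms(2) by auto
  have "(g has_real_derivative f' x) (at x)" if "x \<in> S" for x
    using f'(1) assms(1,3) that has_field_derivative_transform_within_open[of f "f' x" x S g] by auto
  then show ?thesis using f'(2) Suc by auto
qed

lemma Cn_on_Un:
  assumes "open S" "open T"
  shows "Cn_on k S f \<Longrightarrow> Cn_on k T f \<Longrightarrow> Cn_on k (S \<union> T) f"
proof (induction k arbitrary: f)
  case 0
  then show ?case using assms by (simp add: continuous_on_open_Un)
next
  case (Suc k)
  obtain f1 where f1: "\<forall>x\<in>S. (f has_real_derivative f1 x) (at x)" "Cn_on k S f1"
    using Suc.prems by auto
  obtain f2 where f2: "\<forall>x\<in>T. (f has_real_derivative f2 x) (at x)" "Cn_on k T f2"
    using Suc.prems by auto
  have d1: "deriv f x = f1 x" if "x \<in> S" for x using f1(1) that by (intro DERIV_imp_deriv) auto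
  have d2: "deriv f x = f2 x" if "x \<in> T" for x using f2(1) that by (intro DERIV_imp_deriv) auto
  have "Cn_on k S (deriv f)" by (rule Cn_on_cong[OF assms(1) f1(2)]) (simp add: d1)
  moreover have "Cn_on k T (deriv f)" by (rule Cn_on_cong[OF assms(2) f2(2)]) (simp add: d2)
  moreover have "\<forall>x\<in>S \<union> T. (f has_real_derivative deriv f x) (at x)"
    using f1(1) f2(1) d1 d2 by auto
  ultimately show ?case using Suc.IH by auto
qed

lemma Cn_on_const: "Cn_on k S (\<lambda>x. c)"
proof (induction k arbitrary: c)
  case (Suc k)
  then show ?case by (auto intro!: exI[of _ "\<lambda>_. 0"])
qed auto

lemma Cn_on_ident: "Cn_on k S (\<lambda>x. x)"
  by (cases k) (auto intro!: exI[of _ "\<lambda>_. 1"] Cn_on_const)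

lemma Cn_on_add: "Cn_on k S f \<Longrightarrow> Cn_on k S g \<Longrightarrow> Cn_on k S (\<lambda>x. f x + g x)"
proof (induction k arbitrary: f g)
  case 0
  then show ?case by (auto intro: continuous_intros)
next
  case (Suc k)
  obtain f' where f': "\<forall>x\<in>S. (f has_real_derivative f' x) (at x)" "Cn_on k S f'"
    using Suc.prems by auto
  obtain g' where g': "\<forall>x\<in>S. (g has_real_derivative g' x) (at x)" "Cn_on k S g'"
    using Suc.prems by auto
  show ?case
    using f' g' Suc.IH[OF f'(2) g'(2)]
    by (auto intro!: exI[of _ "\<lambda>x. f' x + g' x"] derivative_intros)
qed

lemma Cn_on_mult: "Cn_on k S f \<Longrightarrow> Cn_on k S g \<Longrightarrow> Cn_on k S (\<lambda>x. f x * g x)"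
proof (induction k arbitrary: f g)
  case 0
  then show ?case by (auto intro: continuous_intros)
next
  case (Suc k)
  obtain f' where f': "\<forall>x\<in>S. (f has_real_derivative f' x) (at x)" "Cn_on k S f'"
    using Suc.prems by auto
  obtain g' where g': "\<forall>x\<in>S. (g has_real_derivative g' x) (at x)" "Cn_on k S g'"
    using Suc.prems by auto
  have "Cn_on k S (\<lambda>x. f' x * g x + g' x * f x)"
    using f'(2) g'(2) Suc.prems[THEN Cn_on_SucD] by (intro Cn_on_add Suc.IH) auto
  moreover have "\<forall>x\<in>S. ((\<lambda>x. f x * g x) has_real_derivative f' x * g x + g' x * f x) (at x)"
    using f'(1) g'(1) by (intro ballI DERIV_mult) auto
  ultimately show ?case by auto
qed

lemma Cn_on_compose:
  "Cn_on k T f \<Longrightarrow> Cn_on k S g \<Longrightarrow> g ` S \<subseteq> T \<Longrightarrow> Cn_on k S (\<lambda>x. f (g x))"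
proof (induction k arbitrary: f)
  case 0
  then show ?case by (auto intro: continuous_on_compose2)
next
  case (Suc k)
  obtain f' where f': "\<forall>x\<in>T. (f has_real_derivative f' x) (at x)" "Cn_on k T f'"
    using Suc.prems by auto
  obtain g' where g': "\<forall>x\<in>S. (g has_real_derivative g' x) (at x)" "Cn_on k S g'"
    using Suc.prems by auto
  have "Cn_on k S (\<lambda>x. f' (g x) * g' x)"
    by (rule Cn_on_mult[OF Suc.IH[OF f'(2) Cn_on_SucD[OF Suc.prems(2)] Suc.prems(3)] g'(2)])
  moreover have "\<forall>x\<in>S. ((\<lambda>x. f (g x)) has_real_derivative f' (g x) * g' x) (at x)"
    using f'(1) g'(1) Suc.prems(3) by (intro ballI DERIV_chain2) auto
  ultimately show ?case
    unfolding Cn_on.simps(2) by (intro exI[of _ "\<lambda>x. f' (g x) * g' x"] conjI)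
qed

lemma Cn_on_powr: "Cn_on k {0<..} (\<lambda>x. x powr a)"
proof (induction k arbitrary: a)
  case 0
  then show ?case by (auto intro!: continuous_intros)
next
  case (Suc k)
  have "Cn_on k {0<..} (\<lambda>x. a * x powr (a - 1))"
    by (intro Cn_on_mult Cn_on_const Suc)
  then show ?case
    by (auto intro!: exI[of _ "\<lambda>x. a * x powr (a - 1)"] derivative_eq_intros)
qed

lemma Cn_on_ln: "Cn_on k {0<..} (ln :: real \<Rightarrow> real)"
proof (cases k)
  case 0
  then show ?thesis by (auto intro!: continuous_intros)
next
  case (Suc j)
  have "\<forall>x\<in>{0<..}. (ln has_real_derivative x powr (-1)) (at x)"
    using DERIV_ln by (simp add: powr_minus)
  then show ?thesis using Cn_on_powr[of j "-1"] unfolding Suc Cn_on.simps(2)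
    by (intro exI[of _ "\<lambda>x. x powr (-1)"]) simp
qed

text \<open>\<open>flat 0\<close> is the standard smooth function that vanishes on the negative half-line. Dividing by
  powers of the argument gives a family closed under differentiation.\<close>
definition flat :: "nat \<Rightarrow> real \<Rightarrow> real" where
  "flat j s = (if s > 0 then exp (- (1 / s)) * (1 / s) ^ j else 0)"

lemma flat_nonneg: "flat j s \<ge> 0" by (simp add: flat_def)

lemma flat_le_0: "s \<le> 0 \<Longrightarrow> flat j s = 0" by (simp add: flat_def)

lemma flat_0_le_1: "flat 0 s \<le> 1" by (simp add: flat_def)

lemma DERIV_flat:
  "(flat j has_real_derivative (flat (j + 2) s - real j * flat (j + 1) s)) (at s)"
proof -
  consider "s > 0" | "s < 0" | "s = 0" by linarith
  then show ?thesis
  proof cases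
    case 1
    have 0: "((\<lambda>s. - (1 / s)) has_real_derivative (1 / s)\<^sup>2) (at s)"
      using 1 by (auto intro!: derivative_eq_intros simp: power2_eq_square)
    have "((\<lambda>s. 1 / s) has_real_derivative - (1 / s)\<^sup>2) (at s)"
      using 1 by (auto intro!: derivative_eq_intros simp: power2_eq_square)
    from DERIV_mult[OF DERIV_fun_exp[OF 0] DERIV_power[OF this, of j]]
    have "((\<lambda>s. exp (- (1 / s)) * (1 / s) ^ j) has_real_derivative
        (flat (j + 2) s - real j * flat (j + 1) s)) (at s)"
      by (rule DERIV_cong)
        (use 1 in \<open>cases j; simp add: flat_def power2_eq_square algebra_simps add_divide_distrib\<close>)
    then show ?thesis
      by (rule has_field_derivative_transform_within_open[of _ _ _ "{0<..}"])
        (use 1 in \<open>auto simp: flat_def\<close>)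
  next
    case 2
    have "((\<lambda>s. 0) has_real_derivative (flat (j + 2) s - real j * flat (j + 1) s)) (at s)"
      using 2 by (simp add: flat_def)
    then show ?thesis
      by (rule has_field_derivative_transform_within_open[of _ _ _ "{..<0}"])
        (use 2 in \<open>auto simp: flat_def\<close>)
  next
    case 3
    have "((\<lambda>h::real. exp (- (1 / h)) * (1 / h) ^ (j + 1)) \<longlongrightarrow> 0) (at_right 0)"
      by real_asymp
    then have "((\<lambda>h. flat j h / h) \<longlongrightarrow> 0) (at_right 0)"
      by (rule Lim_transform_eventually)
        (auto simp: eventually_at_filter flat_def field_simps)
    moreover have "((\<lambda>h. flat j h / h) \<longlongrightarrow> 0) (at_left 0)"
      by (rule tendsto_eventually) (auto simp: eventually_at_filter flat_def)
    ultimately have "((\<lambda>h. flat j h / h) \<longlongrightarrow> 0) (at 0)"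
      by (simp add: filterlim_split_at)
    then show ?thesis using 3 by (simp add: DERIV_def flat_def)
  qed
qed

lemma Cn_on_flat: "Cn_on k S (flat j)"
proof (induction k arbitrary: j)
  case 0
  then show ?case
    using DERIV_flat by (auto intro!: continuous_at_imp_continuous_on dest: DERIV_isCont)
next
  case (Suc k)
  have "Cn_on k S (\<lambda>s. flat (j + 2) s + (- real j) * flat (j + 1) s)"
    by (intro Cn_on_add Cn_on_mult Cn_on_const Suc)
  then show ?case
    using DERIV_flat[of j] by (intro Cn_on.simps(2)[THEN iffD2] exI conjI) auto
qed

text \<open>\<open>flat 2\<close> is the derivative of \<open>flat 0\<close>. The shift by one matches the argument \<open>m y - 1\<close>
  of the cut-offs below, for which \<open>s + 1 = m y\<close>. The bound comes from the quadratic Taylor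
  polynomial of \<open>exp (1 / s)\<close>.\<close>
lemma flat_2_bound: "s > 0 \<Longrightarrow> (s + 1) * flat 2 s \<le> (s + 1) / (s\<^sup>2 + s + 1 / 2)"
proof -
  assume s: "s > 0"
  have "1 + 1 / s + (1 / s)\<^sup>2 / 2 \<le> exp (1 / s)"
    using exp_lower_Taylor_quadratic[of "1 / s"] s by simp
  then have "s\<^sup>2 * (1 + 1 / s + (1 / s)\<^sup>2 / 2) \<le> s\<^sup>2 * exp (1 / s)"
    by (intro mult_left_mono) auto
  then have "s\<^sup>2 + s + 1 / 2 \<le> s\<^sup>2 * exp (1 / s)"
    using s by (simp add: distrib_left power2_eq_square)
  then have "1 / (s\<^sup>2 * exp (1 / s)) \<le> 1 / (s\<^sup>2 + s + 1 / 2)"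
    using s by (intro divide_left_mono) (auto intro!: mult_pos_pos add_pos_pos)
  moreover have "flat 2 s = 1 / (s\<^sup>2 * exp (1 / s))"
    using s by (simp add: flat_def exp_minus power2_eq_square field_simps)
  ultimately show ?thesis
    using s mult_left_mono[of "flat 2 s" "1 / (s\<^sup>2 + s + 1 / 2)" "s + 1"] by simp
qed

lemma flat_2_le_2: "(s + 1) * flat 2 s \<le> 2"
proof (cases "s > 0")
  case True
  have "(s + 1) / (s\<^sup>2 + s + 1 / 2) \<le> 2"
    using True by (subst pos_divide_le_eq) (auto intro!: add_pos_pos simp: field_simps)
  then show ?thesis using flat_2_bound[OF True] by linarith
qed (simp add: flat_def)

lemma flat_0_tendsto:
  assumes "y > 0" shows "(\<lambda>m. flat 0 (real m * y - 1)) \<longlonglongrightarrow> 1"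
proof -
  have "((\<lambda>s::real. exp (- (1 / s))) \<longlongrightarrow> 1) at_top" by real_asymp
  then have "(flat 0 \<longlongrightarrow> 1) at_top"
    by (rule Lim_transform_eventually)
      (auto simp: flat_def eventually_at_top_linorder intro!: exI[of _ 1])
  moreover have "filterlim (\<lambda>m. real m * y - 1) at_top sequentially"
    using assms by real_asymp
  ultimately show ?thesis by (rule filterlim_compose)
qed

lemma flat_2_tendsto:
  assumes "y > 0" shows "(\<lambda>m. real m * y * flat 2 (real m * y - 1)) \<longlonglongrightarrow> 0"
proof -
  have "((\<lambda>s::real. (s + 1) * (exp (- (1 / s)) * (1 / s) ^ 2)) \<longlongrightarrow> 0) at_top" by real_asymp
  then have "((\<lambda>s. (s + 1) * flat 2 s) \<longlongrightarrow> 0) at_top"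
    by (rule Lim_transform_eventually)
      (auto simp: flat_def eventually_at_top_linorder intro!: exI[of _ 1])
  moreover have "filterlim (\<lambda>m. real m * y - 1) at_top sequentially"
    using assms by real_asymp
  ultimately have "(\<lambda>m. ((real m * y - 1) + 1) * flat 2 (real m * y - 1)) \<longlonglongrightarrow> 0"
    by (rule filterlim_compose)
  then show ?thesis by simp
qed

section \<open>Radial test functions and the divergence theorem\<close>

lemma has_derivative_grad:
  assumes "f differentiable (at x)"
  shows "(f has_derivative (\<lambda>h. grad f x \<bullet> h)) (at x)"
proof -
  have D: "(f has_derivative frechet_derivative f (at x)) (at x)"
    using assms frechet_derivative_works by blast
  have "frechet_derivative f (at x) h = grad f x \<bullet> h" for h
  proof -
    have "linear (frechet_derivative f (at x))"
      using D has_derivative_linear by blast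
    then have "frechet_derivative f (at x) (\<Sum>i\<in>UNIV. h $ i *\<^sub>R axis i 1)
        = (\<Sum>i\<in>UNIV. h $ i * frechet_derivative f (at x) (axis i 1))"
      by (simp add: linear_sum linear_scale)
    moreover have "(\<Sum>i\<in>UNIV. h $ i *\<^sub>R axis i 1) = h"
      by (simp add: basis_expansion flip: scalar_mult_eq_scaleR)
    ultimately show ?thesis by (simp add: grad_def inner_vec_def mult.commute)
  qed
  then show ?thesis using D by presburger
qed

lemma grad_eqI:
  assumes "(f has_derivative (\<lambda>h. v \<bullet> h)) (at x)"
  shows "grad f x = v"
  using assms by (auto simp: grad_def vec_eq_iff inner_axis frechet_derivative_at[OF assms, symmetric])

lemma C_k_imp_continuous_on: "C_k k f \<Longrightarrow> continuous_on UNIV f"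
  by (cases k) (auto intro: differentiable_imp_continuous_on)

lemma C_k_SucD: "C_k (Suc k) f \<Longrightarrow> C_k k f"
proof (induction k arbitrary: f)
  case 0
  then show ?case using C_k_imp_continuous_on[of "Suc 0" f] by simp
next
  case (Suc k)
  then show ?case unfolding C_k.simps(2)[of "Suc k"] by auto
qed

lemma C_k_const: "C_k k (\<lambda>x::real^'n. c)"
proof (induction k arbitrary: c)
  case (Suc k)
  have "grad (\<lambda>_::real^'n. c) = (\<lambda>_. 0)" for c
    by (intro ext grad_eqI) auto
  then show ?case using Suc by simp
qed auto

lemma C_k_coord: "C_k k (\<lambda>x::real^'n. x $ i)"
proof (cases k)
  case (Suc j)
  have D: "((\<lambda>x::real^'n. x $ i) has_derivative (\<lambda>h. h $ i)) (at x)" for x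
    by (intro bounded_linear_imp_has_derivative bounded_linear_vec_nth)
  have "grad (\<lambda>x::real^'n. x $ i) = (\<lambda>_. axis i 1)"
    by (intro ext grad_eqI) (simp add: inner_axis' D)
  moreover have "(\<lambda>x::real^'n. x $ i) differentiable_on UNIV"
    using D by (auto simp: differentiable_on_def differentiable_def)
  ultimately show ?thesis using Suc by (simp add: C_k_const)
qed (auto intro!: continuous_intros)

lemma C_k_add:
  "C_k k f \<Longrightarrow> C_k k g \<Longrightarrow> C_k k (\<lambda>x. f x + g x)"
proof (induction k arbitrary: f g)
  case (Suc k)
  have "grad (\<lambda>x. f x + g x) x = grad f x + grad g x" for x
    using Suc.prems by (intro grad_eqI)
      (auto intro!: derivative_eq_intros has_derivative_grad
        simp: inner_add_left differentiable_on_def)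
  then show ?case using Suc by (auto intro!: differentiable_on_add)
qed (auto intro: continuous_intros)

lemma C_k_mult:
  "C_k k f \<Longrightarrow> C_k k g \<Longrightarrow> C_k k (\<lambda>x. f x * g x)"
proof (induction k arbitrary: f g)
  case (Suc k)
  have "grad (\<lambda>x. f x * g x) x = f x *\<^sub>R grad g x + g x *\<^sub>R grad f x" for x
    using Suc.prems by (intro grad_eqI)
      (auto intro!: derivative_eq_intros has_derivative_grad
        simp: inner_add_left differentiable_on_def)
  moreover have "C_k k (\<lambda>x. f x * grad g x $ i + g x * grad f x $ i)" for i
    using Suc.prems[THEN C_k_SucD] Suc.prems by (intro C_k_add Suc.IH) auto
  ultimately show ?case using Suc.prems by (auto intro!: differentiable_on_mult)
qed (auto intro: continuous_intros)

lemma has_derivative_radial: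
  fixes x :: "'a::real_inner"
  assumes "(F has_real_derivative D) (at (x \<bullet> x))"
  shows "((\<lambda>x. F (x \<bullet> x)) has_derivative (\<lambda>h. ((2 * D) *\<^sub>R x) \<bullet> h)) (at x)"
proof -
  have "((\<lambda>x. x \<bullet> x) has_derivative (\<lambda>h. 2 * (x \<bullet> h))) (at x)"
    by (auto intro!: derivative_eq_intros simp: inner_commute)
  from has_derivative_compose[OF this assms[unfolded has_field_derivative_def]]
  show ?thesis by (simp add: mult_ac)
qed

lemma grad_radial:
  "(F has_real_derivative D) (at (x \<bullet> x)) \<Longrightarrow> grad (\<lambda>x. F (x \<bullet> x)) x = (2 * D) *\<^sub>R x"
  by (intro grad_eqI has_derivative_radial)

text \<open>Each partial derivative of \<open>F (x \<bullet> x)\<close> is a coordinate times a function of the same form, so the induction needs only products.\<close>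
lemma C_k_radial: "Cn_on k UNIV F \<Longrightarrow> C_k k (\<lambda>x::real^'n. F (x \<bullet> x))"
proof (induction k arbitrary: F)
  case 0
  then show ?case
    using continuous_on_compose2[of UNIV F UNIV "\<lambda>x::real^'n. x \<bullet> x"]
    by (simp add: continuous_on_inner)
next
  case (Suc k)
  then obtain F' where F': "\<And>t. (F has_real_derivative F' t) (at t)" "Cn_on k UNIV F'"
    by auto
  have "C_k k (\<lambda>x::real^'n. 2 * F' (x \<bullet> x) * x $ i)" for i
    by (rule C_k_mult[OF C_k_mult[OF C_k_const Suc.IH[OF F'(2)]] C_k_coord])
  moreover have "(\<lambda>x::real^'n. F (x \<bullet> x)) differentiable_on UNIV"
    using has_derivative_radial[OF F'(1)]
    by (auto simp: differentiable_on_def differentiable_def)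
  ultimately show ?case by (simp add: grad_radial[OF F'(1)])
qed

lemma test_function_C_k: "\<phi> \<in> test_functions \<Omega> \<Longrightarrow> C_k k \<phi>"
  by (simp add: test_functions_def)

lemma test_function_differentiable:
  "\<phi> \<in> test_functions \<Omega> \<Longrightarrow> \<phi> differentiable (at x)"
  using test_function_C_k[of \<phi> \<Omega> "Suc 0"] by (simp add: differentiable_on_def)

lemma test_function_continuous:
  assumes "\<phi> \<in> test_functions \<Omega>"
  shows "continuous_on UNIV \<phi>" "continuous_on UNIV (grad \<phi>)"
proof -
  have "continuous_on UNIV (\<lambda>x. grad \<phi> x $ i)" for i
    using test_function_C_k[OF assms, of "Suc 0"] by simp
  then have "continuous_on UNIV (\<lambda>x. \<chi> i. grad \<phi> x $ i)"
    by (rule continuous_on_vec_lambda)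
  then show "continuous_on UNIV (grad \<phi>)" by simp
  show "continuous_on UNIV \<phi>"
    by (rule C_k_imp_continuous_on[OF test_function_C_k[OF assms]])
qed

lemma test_function_zero:
  assumes "\<phi> \<in> test_functions \<Omega>" "x \<notin> closure {x. \<phi> x \<noteq> 0}"
  shows "\<phi> x = 0" "grad \<phi> x = 0"
proof -
  show "\<phi> x = 0" using assms(2) closure_subset[of "{x. \<phi> x \<noteq> 0}"] by auto
  have "((\<lambda>_. 0) has_derivative (\<lambda>h. 0 \<bullet> h)) (at x)" by simp
  then have "(\<phi> has_derivative (\<lambda>h. 0 \<bullet> h)) (at x)"
    by (rule has_derivative_transform_within_open[where s = "- closure {x. \<phi> x \<noteq> 0}"])
      (use assms(2) closure_subset[of "{x. \<phi> x \<noteq> 0}"] in auto)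
  then show "grad \<phi> x = 0" by (rule grad_eqI)
qed

lemma lborel_integral_scaleR:
  fixes f :: "'a::euclidean_space \<Rightarrow> real"
  assumes "f \<in> borel_measurable borel" "c > 0"
  shows "(\<integral>x. f (c *\<^sub>R x) \<partial>lborel) = (\<integral>x. f x \<partial>lborel) / c ^ DIM('a)"
proof -
  have "(\<integral>x. f x \<partial>lborel)
      = (\<integral>x. f x \<partial>density (distr lborel borel (\<lambda>x::'a. 0 + c *\<^sub>R x)) (\<lambda>_. \<bar>c\<bar>^DIM('a)))"
    using lborel_affine[of c "0::'a"] assms(2) by simp
  also have "\<dots> = (\<integral>x. c ^ DIM('a) * f (c *\<^sub>R x) \<partial>lborel)"
    using assms by (subst integral_density) (auto simp: integral_distr)
  finally show ?thesis using assms(2) by simp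
qed

lemma test_function_bounds:
  fixes \<phi> :: "real^'n \<Rightarrow> real"
  assumes "\<phi> \<in> test_functions \<Omega>"
  obtains M where "M > 0" "\<And>x. \<bar>\<phi> x\<bar> \<le> M" "\<And>x. norm (grad \<phi> x) \<le> M"
proof -
  let ?K = "closure {x. \<phi> x \<noteq> 0}"
  have K: "compact ?K" using assms by (auto simp: test_functions_def)
  have "bounded (\<phi> ` ?K)" "bounded (grad \<phi> ` ?K)"
    using test_function_continuous[OF assms] K
    by (auto intro!: compact_imp_bounded compact_continuous_image intro: continuous_on_subset)
  then obtain a b where a: "\<forall>x\<in>?K. norm (\<phi> x) \<le> a" and b: "\<forall>x\<in>?K. norm (grad \<phi> x) \<le> b"
    unfolding bounded_iff by blast
  show ?thesis
  proof (rule that[of "max 1 (max a b)"])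
    fix x
    show "\<bar>\<phi> x\<bar> \<le> max 1 (max a b)"
      using a[rule_format, of x] test_function_zero(1)[OF assms, of x] by (cases "x \<in> ?K") auto
    show "norm (grad \<phi> x) \<le> max 1 (max a b)"
      using b[rule_format, of x] test_function_zero(2)[OF assms, of x] by (cases "x \<in> ?K") auto
  qed simp
qed

text \<open>The divergence theorem for the field \<open>\<phi>(x) x\<close>, obtained from scaling:
  \<open>\<integral>\<phi>(s x) dx = s powr - n \<integral>\<phi>\<close>, and differentiation at \<open>s = 1\<close>
  gives the two sides. The difference quotients are taken along \<open>s = 1 + 1 / (k + 1)\<close>; as \<open>s > 1\<close>, they
  all vanish outside a fixed ball containing the support of \<open>\<phi>\<close>, where a Lipschitz bound for \<open>\<phi>\<close>
  makes dominated convergence applicable.\<close>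
lemma integral_grad_inner_position:
  fixes \<phi> :: "real^'n \<Rightarrow> real"
  assumes \<phi>: "\<phi> \<in> test_functions \<Omega>"
  shows "(\<integral>x. grad \<phi> x \<bullet> x \<partial>lborel) = - real CARD('n) * (\<integral>x. \<phi> x \<partial>lborel)"
proof -
  obtain M where M: "M > 0" "\<And>x. norm (grad \<phi> x) \<le> M"
    using test_function_bounds[OF \<phi>] by metis
  have "bounded (closure {x. \<phi> x \<noteq> 0})"
    using \<phi> compact_imp_bounded by (auto simp: test_functions_def simp del: bounded_closure)
  then obtain R where R: "\<forall>x\<in>closure {x. \<phi> x \<noteq> 0}. norm x \<le> R"
    unfolding bounded_iff by (elim exE)
  have supp: "\<phi> x = 0" if "x \<notin> cball 0 R" for x
  proof -
    have "x \<notin> closure {x. \<phi> x \<noteq> 0}" using R that by (meson mem_cball_0)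
    then show ?thesis by (rule test_function_zero(1)[OF \<phi>])
  qed
  have [measurable]: "\<phi> \<in> borel_measurable borel" "grad \<phi> \<in> borel_measurable borel"
    using test_function_continuous[OF \<phi>] by (auto intro: borel_measurable_continuous_onI)
  define c where "c k = 1 + 1 / real (Suc k)" for k
  have c1: "c k > 1" for k by (simp add: c_def)
  define D where "D k x = real (Suc k) * (\<phi> (c k *\<^sub>R x) - \<phi> x)" for k x
  have int0: "integrable lborel \<phi>"
  proof (rule Bochner_Integration.integrable_cong[THEN iffD1, OF refl _ borel_integrable_compact[of "cball 0 R" \<phi>]])
    show "continuous_on (cball 0 R) \<phi>"
      using test_function_continuous[OF \<phi>] by (auto intro: continuous_on_subset)
  qed (use supp in \<open>auto simp: indicator_def\<close>)
  have intc: "integrable lborel (\<lambda>x. \<phi> (c k *\<^sub>R x))" for k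
  proof -
    have supp': "x \<in> cball 0 R" if "\<phi> (c k *\<^sub>R x) \<noteq> 0" for x
    proof -
      have "norm (c k *\<^sub>R x) \<le> R" using supp[of "c k *\<^sub>R x"] that by auto
      moreover have "norm x \<le> norm (c k *\<^sub>R x)"
        using c1[of k] mult_right_mono[of 1 "c k" "norm x"] by simp
      ultimately show ?thesis by simp
    qed
    show ?thesis
    proof (rule Bochner_Integration.integrable_cong[THEN iffD1, OF refl _ borel_integrable_compact[of "cball 0 R" "\<lambda>x. \<phi> (c k *\<^sub>R x)"]])
      show "continuous_on (cball 0 R) (\<lambda>x. \<phi> (c k *\<^sub>R x))"
        by (rule continuous_on_compose2[OF test_function_continuous(1)[OF \<phi>]])
          (auto intro: continuous_intros)
    qed (use supp' in \<open>auto simp: indicator_def\<close>)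
  qed
  have lim1: "(\<lambda>k. \<integral>x. D k x \<partial>lborel) \<longlonglongrightarrow> (\<integral>x. grad \<phi> x \<bullet> x \<partial>lborel)"
  proof (rule integral_dominated_convergence[where w = "\<lambda>x. M * R * indicator (cball 0 R) x"])
    show "integrable lborel (\<lambda>x::real^'n. M * R * indicator (cball 0 R) x)"
      by (intro integrable_mult_right integrable_real_indicator) (auto intro!: emeasure_bounded_finite simp flip: infinity_ennreal_def)
    show "AE x in lborel. (\<lambda>k. D k x) \<longlonglongrightarrow> grad \<phi> x \<bullet> x"
    proof (rule AE_I2)
      fix x :: "real^'n"
      have "((\<lambda>t. \<phi> (x + t *\<^sub>R x)) has_derivative (\<lambda>t. grad \<phi> x \<bullet> (t *\<^sub>R x))) (at 0)"
        by (rule has_derivative_compose[of "\<lambda>t. x + t *\<^sub>R x" "\<lambda>t. t *\<^sub>R x" 0 UNIV \<phi>])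
          (use has_derivative_grad[OF test_function_differentiable[OF \<phi>], of x] in
            \<open>auto intro!: derivative_eq_intros\<close>)
      then have "((\<lambda>t. \<phi> (x + t *\<^sub>R x)) has_real_derivative (grad \<phi> x \<bullet> x)) (at 0)"
        by (simp add: has_field_derivative_def mult_commute_abs)
      then have "((\<lambda>h. (\<phi> (x + h *\<^sub>R x) - \<phi> x) / h) \<longlongrightarrow> grad \<phi> x \<bullet> x) (at 0)"
        by (simp add: DERIV_def)
      moreover have "filterlim (\<lambda>k. 1 / real (Suc k)) (at 0) sequentially"
        by real_asymp
      ultimately have "(\<lambda>k. (\<phi> (x + (1 / real (Suc k)) *\<^sub>R x) - \<phi> x) / (1 / real (Suc k)))
          \<longlonglongrightarrow> grad \<phi> x \<bullet> x"
        by (rule filterlim_compose)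
      then show "(\<lambda>k. D k x) \<longlonglongrightarrow> grad \<phi> x \<bullet> x"
        by (simp add: D_def c_def scaleR_add_left mult.commute)
    qed
    show "AE x in lborel. norm (D k x) \<le> M * R * indicator (cball 0 R) x" for k
    proof (rule AE_I2)
      fix x :: "real^'n"
      show "norm (D k x) \<le> M * R * indicator (cball 0 R) x"
      proof (cases "x \<in> cball 0 R")
        case True
        have "norm (\<phi> (c k *\<^sub>R x) - \<phi> x) \<le> M * norm (c k *\<^sub>R x - x)"
        proof (rule differentiable_bound[of UNIV _ "\<lambda>y h. grad \<phi> y \<bullet> h"])
          show "(\<phi> has_derivative (\<lambda>h. grad \<phi> y \<bullet> h)) (at y within UNIV)" for y
            using has_derivative_grad[OF test_function_differentiable[OF \<phi>]] by simp
          show "onorm (\<lambda>h. grad \<phi> y \<bullet> h) \<le> M" for y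
          proof (rule onorm_le)
            show "norm (grad \<phi> y \<bullet> h) \<le> M * norm h" for h
              using Cauchy_Schwarz_ineq2[of "grad \<phi> y" h] mult_right_mono[OF M(2)[of y], of "norm h"]
              by simp
          qed
        qed auto
        also have "norm (c k *\<^sub>R x - x) = norm x / real (Suc k)"
          by (simp add: c_def scaleR_add_left)
        finally have "real (Suc k) * norm (\<phi> (c k *\<^sub>R x) - \<phi> x)
            \<le> real (Suc k) * (M * (norm x / real (Suc k)))"
          by (rule mult_left_mono) simp
        then have "norm (D k x) \<le> M * norm x"
          by (simp add: D_def abs_mult del: of_nat_Suc)
        moreover have "M * norm x \<le> M * R" using True M(1) by (intro mult_left_mono) auto
        ultimately show ?thesis using True by simp
      next
        case False
        have "norm x \<le> norm (c k *\<^sub>R x)"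
          using c1[of k] mult_right_mono[of 1 "c k" "norm x"] by simp
        then show ?thesis using False supp[of x] supp[of "c k *\<^sub>R x"] by (simp add: D_def)
      qed
    qed
  qed (auto simp: D_def)
  have eq: "(\<integral>x. D k x \<partial>lborel)
      = (real (Suc k) * (1 / c k ^ CARD('n) - 1)) * (\<integral>x. \<phi> x \<partial>lborel)" for k
    using lborel_integral_scaleR[of \<phi> "c k"] c1[of k] int0 intc[of k]
    by (simp add: D_def left_diff_distrib del: of_nat_Suc)
  have lim2: "(\<lambda>k. real (Suc k) * (1 / c k ^ CARD('n) - 1)) \<longlonglongrightarrow> - real CARD('n)"
  proof -
    have "((\<lambda>t::real. 1 / (1 + t) ^ CARD('n)) has_real_derivative - real CARD('n)) (at 0)"
      by (auto intro!: derivative_eq_intros)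
    then have "((\<lambda>h::real. (1 / (1 + h) ^ CARD('n) - 1) / h) \<longlongrightarrow> - real CARD('n)) (at 0)"
      by (simp add: DERIV_def)
    moreover have "filterlim (\<lambda>k. 1 / real (Suc k)) (at 0) sequentially"
      by real_asymp
    ultimately have "(\<lambda>k. (1 / (1 + 1 / real (Suc k)) ^ CARD('n) - 1) / (1 / real (Suc k)))
        \<longlonglongrightarrow> - real CARD('n)"
      by (rule filterlim_compose)
    then show ?thesis by (simp add: c_def mult.commute)
  qed
  show ?thesis
    by (rule LIMSEQ_unique[OF lim1[unfolded eq] tendsto_mult_right[OF lim2]])
qed

section \<open>Smooth approximations of the dual function\<close>

text \<open>\<open>L powr d\<close>, as a function of \<open>t = |x|\<^sup>2\<close>.\<close>
definition log_weight :: "real \<Rightarrow> real \<Rightarrow> real" where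
  "log_weight d t = (- ln t / 2) powr d"

text \<open>The factor \<open>W\<close>: its derivative in \<open>t\<close> is \<open>- log_weight (- d) t / 2\<close>, so that
  \<open>L powr d \<nabla>W = - x\<close>, and it vanishes at \<open>t = exp (- 2)\<close>, that is, on the boundary sphere.\<close>
definition profile :: "real \<Rightarrow> real \<Rightarrow> real" where
  "profile d t = integral {t..exp (-2)} (\<lambda>\<tau>. log_weight (- d) \<tau> / 2)"

lemma exp_neg_2_less_1: "exp (- 2) < (1::real)" by simp

lemma neg_half_ln_gt_1:
  fixes t :: real
  assumes "0 < t" "t < exp (-2)" shows "1 < - ln t / 2"
proof -
  have "ln t < - 2" using assms ln_less_cancel_iff[of t "exp (-2)"] by simp
  then show ?thesis by simp
qed

lemma neg_half_ln_ge_1: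
  fixes t :: real
  assumes "0 < t" "t \<le> exp (-2)" shows "1 \<le> - ln t / 2"
proof -
  have "ln t \<le> - 2" using assms ln_le_cancel_iff[of t "exp (-2)"] by simp
  then show ?thesis by simp
qed

lemma continuous_on_log_weight: "continuous_on {0<..<1} (log_weight d)"
  unfolding log_weight_def by (intro continuous_intros) auto

lemma Cn_on_log_weight: "Cn_on k {0<..<1} (log_weight d)"
proof -
  have "Cn_on k {0<..<1} (\<lambda>t. (- 1 / 2) * ln t)"
    by (rule Cn_on_mult[OF Cn_on_const Cn_on_subset[OF Cn_on_ln]]) auto
  then have "Cn_on k {0<..<1} (\<lambda>t. ((- 1 / 2) * ln t) powr d)"
    by (rule Cn_on_compose[OF Cn_on_powr]) auto
  then show ?thesis by (simp add: log_weight_def[abs_def])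
qed

lemma DERIV_log_weight:
  assumes "0 < t" "t < 1"
  shows "(log_weight d has_real_derivative - (d * log_weight (d - 1) t / (2 * t))) (at t)"
  unfolding log_weight_def using assms
  by (auto intro!: derivative_eq_intros simp: powr_diff field_simps)

lemma profile_integrable:
  assumes "0 < t" shows "(\<lambda>\<tau>. log_weight (- d) \<tau> / 2) integrable_on {t..exp (-2)}"
  using assms
  by (intro integrable_continuous_real continuous_intros
      continuous_on_subset[OF continuous_on_log_weight]) (auto intro: le_less_trans[OF _ exp_neg_2_less_1] less_trans[OF _ exp_neg_2_less_1])

text \<open>The fundamental theorem of calculus is available for a variable upper end point, hence the base point \<open>t / 2\<close> to the left of \<open>t\<close>.\<close>
lemma DERIV_profile:
  assumes t: "0 < t" "t < exp (-2)"
  shows "(profile d has_real_derivative - (log_weight (- d) t / 2)) (at t)"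
proof -
  let ?\<kappa> = "\<lambda>\<tau>. log_weight (- d) \<tau> / 2"
  have cont: "continuous_on {t/2..exp (-2)} ?\<kappa>"
    using t by (intro continuous_intros continuous_on_subset[OF continuous_on_log_weight])
      (auto intro: le_less_trans[OF _ exp_neg_2_less_1] less_trans[OF _ exp_neg_2_less_1])
  have "((\<lambda>s. integral {t/2..s} ?\<kappa>) has_real_derivative ?\<kappa> t) (at t within {t/2..exp (-2)})"
    using cont t by (intro integral_has_real_derivative) auto
  then have "((\<lambda>s. integral {t/2..s} ?\<kappa>) has_real_derivative ?\<kappa> t) (at t)"
    using t by (simp add: at_within_Icc_at)
  then have "((\<lambda>s. integral {t/2..exp (-2)} ?\<kappa> - integral {t/2..s} ?\<kappa>)
      has_real_derivative - ?\<kappa> t) (at t)"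
    by (rule DERIV_cong[OF DERIV_diff[OF DERIV_const]]) simp
  then show ?thesis
  proof (rule has_field_derivative_transform_within_open[where S = "{t/2<..<exp (-2)}"])
    fix s assume s: "s \<in> {t/2<..<exp (-2)}"
    have "integral {t/2..s} ?\<kappa> + integral {s..exp (-2)} ?\<kappa> = integral {t/2..exp (-2)} ?\<kappa>"
      using s profile_integrable[of "t/2" d] t by (intro Henstock_Kurzweil_Integration.integral_combine) auto
    then show "integral {t/2..exp (-2)} ?\<kappa> - integral {t/2..s} ?\<kappa> = profile d s"
      by (simp add: profile_def)
  qed (use t in auto)
qed

lemma Cn_on_profile: "Cn_on k {0<..<exp (-2)} (profile d)"
proof (cases k)
  case 0
  then show ?thesis
    using DERIV_isCont[OF DERIV_profile] by (auto intro!: continuous_at_imp_continuous_on)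
next
  case (Suc j)
  have "Cn_on j {0<..<exp (-2)} (\<lambda>t. (- 1 / 2) * log_weight (- d) t)"
    by (rule Cn_on_mult[OF Cn_on_const Cn_on_subset[OF Cn_on_log_weight]])
      (auto intro: le_less_trans[OF _ exp_neg_2_less_1] less_trans[OF _ exp_neg_2_less_1])
  moreover have "\<forall>t\<in>{0<..<exp (-2)}.
      (profile d has_real_derivative (- 1 / 2) * log_weight (- d) t) (at t)"
    using DERIV_profile by simp
  ultimately show ?thesis
    unfolding Suc Cn_on.simps(2)
    by (intro exI[of _ "\<lambda>t. (- 1 / 2) * log_weight (- d) t"] conjI)
qed

text \<open>The integrand increases in \<open>t\<close> and is at most \<open>1 / 2\<close> because \<open>L \<ge> 1\<close>. The upper bound makes the
  profile small near the boundary, so that cutting off its small values gives compact support.\<close>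
lemma profile_bounds:
  assumes "d > 0" and t: "0 < t" "t < exp (-2)"
  shows "0 < profile d t" "profile d t \<le> (exp (-2) - t) / 2"
proof -
  let ?\<kappa> = "\<lambda>\<tau>. log_weight (- d) \<tau> / 2"
  have L: "1 < - ln t / 2" by (rule neg_half_ln_gt_1[OF t])
  have lower: "?\<kappa> t \<le> ?\<kappa> \<tau>" and upper: "?\<kappa> \<tau> \<le> 1 / 2" if "\<tau> \<in> {t..exp (-2)}" for \<tau>
  proof -
    have L': "1 \<le> - ln \<tau> / 2" using that t by (intro neg_half_ln_ge_1) auto
    have le: "- ln \<tau> / 2 \<le> - ln t / 2" using that t by simp
    have "(- ln t / 2) powr - d \<le> (- ln \<tau> / 2) powr - d"
      using L' le assms(1) by (intro powr_mono2') auto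
    then show "?\<kappa> t \<le> ?\<kappa> \<tau>" by (simp add: log_weight_def)
    have "(- ln \<tau> / 2) powr - d \<le> 1 powr - d"
      using L' assms(1) by (intro powr_mono2') auto
    then show "?\<kappa> \<tau> \<le> 1 / 2" by (simp add: log_weight_def)
  qed
  have "integral {t..exp (-2)} (\<lambda>_. ?\<kappa> t) \<le> profile d t"
    unfolding profile_def by (rule integral_le) (use lower profile_integrable[OF t(1)] in auto)
  then have "(exp (-2) - t) * ?\<kappa> t \<le> profile d t" using t by simp
  moreover have "?\<kappa> t > 0" using L unfolding log_weight_def by simp
  moreover have "0 < (exp (-2) - t) * ?\<kappa> t"
    using \<open>?\<kappa> t > 0\<close> t by (intro mult_pos_pos) auto
  ultimately show "0 < profile d t" by linarith
  have "profile d t \<le> integral {t..exp (-2)} (\<lambda>_. 1 / 2)"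
    unfolding profile_def by (rule integral_le) (use upper profile_integrable[OF t(1)] in auto)
  then show "profile d t \<le> (exp (-2) - t) / 2" using t by simp
qed

lemma profile_le_1: "d > 0 \<Longrightarrow> 0 < t \<Longrightarrow> t < exp (-2) \<Longrightarrow> profile d t \<le> 1"
proof -
  assume d: "d > 0" and t: "0 < t" "t < exp (-2)"
  have "2 * profile d t \<le> exp (- 2)" using profile_bounds(2)[OF d t] t(1) by simp
  also note exp_neg_2_less_1
  finally show "profile d t \<le> 1" by simp
qed

text \<open>Zero for \<open>y \<le> 1 / m\<close>, and increasing to one with \<open>m\<close> for every \<open>y > 0\<close>.\<close>
definition cutoff :: "nat \<Rightarrow> real \<Rightarrow> real" where
  "cutoff m y = flat 0 (real m * y - 1)"

lemma cutoff_range: "0 \<le> cutoff m y" "cutoff m y \<le> 1"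
  by (simp_all add: cutoff_def flat_nonneg flat_0_le_1)

lemma cutoff_tendsto: "y > 0 \<Longrightarrow> (\<lambda>m. cutoff m y) \<longlonglongrightarrow> 1"
  unfolding cutoff_def by (rule flat_0_tendsto)

lemma DERIV_cutoff:
  "(cutoff m has_real_derivative real m * flat 2 (real m * y - 1)) (at y)"
proof -
  have "((\<lambda>y. real m * y - 1) has_real_derivative real m) (at y)"
    by (auto intro!: derivative_eq_intros)
  from DERIV_chain2[OF DERIV_flat[of 0] this]
  show ?thesis by (simp add: cutoff_def[abs_def] mult.commute numeral_2_eq_2)
qed

text \<open>The first cut-off removes a neighbourhood of the origin, the second a neighbourhood of the
  boundary.\<close>
definition radial_approx :: "real \<Rightarrow> nat \<Rightarrow> real \<Rightarrow> real" where
  "radial_approx d m t =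
     (if 0 < t \<and> t < exp (-2)
      then cutoff m t * cutoff m (profile d t) * profile d t * log_weight d t else 0)"

lemma radial_approx_eq_0:
  assumes "d > 0" "m > 0" "t \<le> 1 / real m \<or> exp (-2) - 2 / real m \<le> t"
  shows "radial_approx d m t = 0"
proof (cases "0 < t \<and> t < exp (-2)")
  case True
  show ?thesis
  proof (cases "t \<le> 1 / real m")
    case True
    then have "real m * t - 1 \<le> 0" using assms(2) by (simp add: field_simps)
    then show ?thesis by (simp add: radial_approx_def cutoff_def flat_le_0)
  next
    case False
    then have "profile d t \<le> 1 / real m"
      using profile_bounds(2)[OF assms(1), of t] True assms(3) by auto
    then have "real m * profile d t - 1 \<le> 0" using assms(2) by (simp add: field_simps)
    then show ?thesis by (simp add: radial_approx_def cutoff_def flat_le_0)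
  qed
qed (auto simp: radial_approx_def)

text \<open>The product formula is smooth where it is used, and the function is zero near both of its ends;
  these three open sets cover the line.\<close>
lemma Cn_on_radial_approx:
  assumes "d > 0" "m > 0"
  shows "Cn_on k UNIV (radial_approx d m)"
proof -
  let ?I = "{0<..<exp (-2) :: real}"
  have lin: "Cn_on k S (\<lambda>y. real m * y + (- 1))" for S
    by (rule Cn_on_add[OF Cn_on_mult[OF Cn_on_const Cn_on_ident] Cn_on_const])
  have cut: "Cn_on k S (cutoff m)" for S
    using Cn_on_compose[OF Cn_on_flat[of k UNIV 0] lin[of S]]
    by (simp add: cutoff_def[abs_def])
  have "Cn_on k ?I (\<lambda>t. cutoff m t * cutoff m (profile d t) * profile d t * log_weight d t)"
    by (intro Cn_on_mult[OF Cn_on_mult[OF Cn_on_mult[OF cut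
            Cn_on_compose[OF cut[of UNIV] Cn_on_profile]] Cn_on_profile]
          Cn_on_subset[OF Cn_on_log_weight]])
      (auto intro: le_less_trans[OF _ exp_neg_2_less_1] less_trans[OF _ exp_neg_2_less_1])
  then have 1: "Cn_on k ?I (radial_approx d m)"
    by (rule Cn_on_cong[rotated]) (auto simp: radial_approx_def)
  have 2: "Cn_on k {..<1 / real m} (radial_approx d m)"
    by (rule Cn_on_cong[OF _ Cn_on_const[of _ _ 0]])
      (use radial_approx_eq_0[OF assms] in auto)
  have 3: "Cn_on k {exp (-2) - 2 / real m<..} (radial_approx d m)"
    by (rule Cn_on_cong[OF _ Cn_on_const[of _ _ 0]])
      (use radial_approx_eq_0[OF assms] in auto)
  have "Cn_on k ((?I \<union> {..<1 / real m}) \<union> {exp (-2) - 2 / real m<..}) (radial_approx d m)"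
    by (intro Cn_on_Un 1 2 3 open_Un) auto
  moreover have "(?I \<union> {..<1 / real m}) \<union> {exp (-2) - 2 / real m<..} = UNIV"
  proof -
    have "t \<in> (?I \<union> {..<1 / real m}) \<union> {exp (-2) - 2 / real m<..}" for t
    proof -
      have "0 < 1 / real m" using assms(2) by simp
      then have "t < 1 / real m \<or> exp (-2) - 2 / real m < t \<or> 0 < t \<and> t < exp (-2)"
        by linarith
      then show ?thesis by auto
    qed
    then show ?thesis by blast
  qed
  ultimately show ?thesis by simp
qed

lemma exp_neg_2: "exp (- 2) = (1 / exp 1 :: real)\<^sup>2"
  by (simp add: power2_eq_square exp_minus divide_inverse flip: exp_add inverse_mult_distrib)

lemma radial_approx_test_function:
  assumes "d > 0" "m > 0"
  shows "(\<lambda>x::real^'n. radial_approx d m (x \<bullet> x)) \<in> test_functions (ball 0 (1 / exp 1))"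
proof -
  let ?\<phi> = "\<lambda>x::real^'n. radial_approx d m (x \<bullet> x)"
  let ?K = "{x::real^'n. x \<bullet> x \<le> exp (-2) - 2 / real m}"
  have K: "?K \<subseteq> ball 0 (1 / exp 1)"
  proof
    fix x assume "x \<in> ?K"
    moreover have "0 < 2 / real m" using assms(2) by simp
    ultimately have "x \<bullet> x < exp (- 2)" by (simp only: mem_Collect_eq)
    then have "(norm x)\<^sup>2 < (1 / exp 1)\<^sup>2"
      by (simp add: exp_neg_2[symmetric] power2_norm_eq_inner)
    then have "norm x < 1 / exp 1" by (rule power_less_imp_less_base) simp
    then show "x \<in> ball 0 (1 / exp 1)" by simp
  qed
  have "closed ?K"
    by (intro closed_Collect_le continuous_intros)
  moreover have "{x. ?\<phi> x \<noteq> 0} \<subseteq> ?K"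
  proof
    fix x assume "x \<in> {x. ?\<phi> x \<noteq> 0}"
    then have "\<not> exp (-2) - 2 / real m \<le> x \<bullet> x"
      using radial_approx_eq_0[OF assms, of "x \<bullet> x"] by blast
    then show "x \<in> ?K" by simp
  qed
  ultimately have cl: "closure {x. ?\<phi> x \<noteq> 0} \<subseteq> ?K" by (rule closure_minimal[rotated])
  have "bounded (closure {x. ?\<phi> x \<noteq> 0})"
    by (rule bounded_subset[OF bounded_ball order_trans[OF cl K]])
  then have "compact (closure {x. ?\<phi> x \<noteq> 0})"
    by (subst compact_eq_bounded_closed) (intro conjI closed_closure)
  then show ?thesis
    using order_trans[OF cl K] C_k_radial[OF Cn_on_radial_approx[OF assms]]
    unfolding test_functions_def by (intro CollectI conjI allI)
qed

text \<open>The last summand comes from differentiating \<open>log_weight d\<close>; it is the one that the drift term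
  cancels. In the middle summand the derivative \<open>- log_weight (- d) / 2\<close> of the profile has
  absorbed the factor \<open>log_weight d\<close>.\<close>
lemma DERIV_radial_approx:
  fixes d t :: real and m :: nat
  defines "\<theta>' \<equiv> \<lambda>y. real m * flat 2 (real m * y - 1)"
  assumes t: "0 < t" "t < exp (-2)"
  shows "(radial_approx d m has_real_derivative
      \<theta>' t * cutoff m (profile d t) * profile d t * log_weight d t
      - cutoff m t * (profile d t * \<theta>' (profile d t) + cutoff m (profile d t)) / 2
      - d * radial_approx d m t / (2 * t * (- ln t / 2))) (at t)"
proof -
  have L: "- ln t / 2 > 1" by (rule neg_half_ln_gt_1[OF t])
  have W: "(profile d has_real_derivative - (log_weight (- d) t / 2)) (at t)"
    by (rule DERIV_profile[OF t])
  have cW: "((\<lambda>t. cutoff m (profile d t)) has_real_derivative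
      \<theta>' (profile d t) * - (log_weight (- d) t / 2)) (at t)"
    unfolding \<theta>'_def by (rule DERIV_chain2[OF DERIV_cutoff W])
  have c: "(cutoff m has_real_derivative \<theta>' t) (at t)"
    unfolding \<theta>'_def by (rule DERIV_cutoff)
  have w: "(log_weight d has_real_derivative - (d * log_weight (d - 1) t / (2 * t))) (at t)"
    using t exp_neg_2_less_1 by (intro DERIV_log_weight) (auto simp del: exp_less_one_iff)
  have inv: "log_weight (- d) t * log_weight d t = 1"
    using L by (simp add: log_weight_def powr_minus)
  have low: "log_weight (d - 1) t = log_weight d t / (- ln t / 2)"
    using L by (simp add: log_weight_def powr_diff)
  have eq: "radial_approx d m t = cutoff m t * cutoff m (profile d t) * profile d t * log_weight d t"
    using t by (simp add: radial_approx_def)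
  define a b W' w' i L' where "a = cutoff m t" and "b = cutoff m (profile d t)"
    and "W' = profile d t" and "w' = log_weight d t" and "i = log_weight (- d) t"
    and "L' = - ln t / 2"
  have "((\<lambda>t. cutoff m t * cutoff m (profile d t) * profile d t * log_weight d t)
      has_real_derivative
      \<theta>' t * cutoff m (profile d t) * profile d t * log_weight d t
      - cutoff m t * (profile d t * \<theta>' (profile d t) + cutoff m (profile d t)) / 2
      - d * radial_approx d m t / (2 * t * (- ln t / 2))) (at t)"
  proof (rule DERIV_cong[OF DERIV_mult[OF DERIV_mult[OF DERIV_mult[OF c cW] W] w]])
    have iw: "i * w' = 1" using inv by (simp add: i_def w'_def)
    have "((\<theta>' t * b + \<theta>' W' * - (i / 2) * a) * W' + - (i / 2) * (a * b)) * w' +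
        - (d * (w' / L') / (2 * t)) * (a * b * W') =
        \<theta>' t * b * W' * w' - (i * w') * (a * (W' * \<theta>' W' + b) / 2) - d * (a * b * W' * w') / (2 * t * L')"
      by (simp add: field_simps)
    then show "((\<theta>' t * cutoff m (profile d t) +
         \<theta>' (profile d t) * - (log_weight (- d) t / 2) * cutoff m t) * profile d t +
        - (log_weight (- d) t / 2) * (cutoff m t * cutoff m (profile d t))) * log_weight d t +
       - (d * log_weight (d - 1) t / (2 * t)) *
       (cutoff m t * cutoff m (profile d t) * profile d t) =
       \<theta>' t * cutoff m (profile d t) * profile d t * log_weight d t -
       cutoff m t * (profile d t * \<theta>' (profile d t) + cutoff m (profile d t)) / 2 -
       d * radial_approx d m t / (2 * t * (- ln t / 2))"
      unfolding low eq iw by (simp add: a_def b_def W'_def w'_def i_def L'_def)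
  qed
  then show ?thesis
    by (rule has_field_derivative_transform_within_open[where S = "{0<..<exp (-2)}"])
      (use t in \<open>auto simp: radial_approx_def\<close>)
qed

lemma ln_inner_self: "x \<noteq> 0 \<Longrightarrow> - ln (x \<bullet> x) / 2 = - ln (norm x)"
  by (simp add: power2_norm_eq_inner[symmetric] ln_realpow)

lemma inner_self_less_exp_neg_2:
  "x \<in> ball 0 (1 / exp 1) \<Longrightarrow> x \<bullet> x < exp (-2)"
  unfolding exp_neg_2 power2_norm_eq_inner[symmetric]
  by (intro power_strict_mono) auto

text \<open>\<open>\<nabla>\<phi> + d c \<phi>\<close> for the approximation \<open>\<phi>\<close>, the field that is paired with
  the gradient of the solution.\<close>
definition approx_field :: "real \<Rightarrow> nat \<Rightarrow> real^'n \<Rightarrow> real^'n" where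
  "approx_field d m x = grad (\<lambda>x. radial_approx d m (x \<bullet> x)) x
     + radial_approx d m (x \<bullet> x) *\<^sub>R (d *\<^sub>R log_drift x)"

lemma approx_field_eq:
  fixes x :: "real^'n" and d :: real
  assumes x: "x \<in> ball 0 (1 / exp 1)" "x \<noteq> 0"
  defines "t \<equiv> x \<bullet> x" and "W \<equiv> profile d (x \<bullet> x)"
  shows "approx_field d m x =
      (2 * (real m * flat 2 (real m * t - 1)) * cutoff m W * W * log_weight d t
        - cutoff m t * (real m * W * flat 2 (real m * W - 1) + cutoff m W)) *\<^sub>R x"
proof -
  have t: "0 < t" "t < exp (-2)"
    using x inner_self_less_exp_neg_2[OF x(1)] by (auto simp: t_def)
  define L R where "L = - ln t / 2" and "R = radial_approx d m t"
  have "L \<noteq> 0" using neg_half_ln_gt_1[OF t] by (simp add: L_def)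
  have drift: "log_drift x = (1 / (t * L)) *\<^sub>R x"
    using ln_inner_self[OF x(2)] by (simp add: log_drift_def t_def L_def power2_norm_eq_inner)
  define D where "D = real m * flat 2 (real m * t - 1) * cutoff m W * W * log_weight d t
      - cutoff m t * (W * (real m * flat 2 (real m * W - 1)) + cutoff m W) / 2
      - d * R / (2 * t * L)"
  have "(radial_approx d m has_real_derivative D) (at (x \<bullet> x))"
    using DERIV_radial_approx[OF t, of d m] unfolding D_def R_def L_def W_def t_def .
  from grad_radial[OF this]
  have "approx_field d m x = (2 * D) *\<^sub>R x + R *\<^sub>R (d *\<^sub>R ((1 / (t * L)) *\<^sub>R x))"
    by (simp add: approx_field_def drift R_def t_def)
  also have "\<dots> = (2 * D + R * (d * (1 / (t * L)))) *\<^sub>R x"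
    by (simp only: scaleR_scaleR scaleR_add_left)
  also have "2 * D + R * (d * (1 / (t * L))) =
      2 * (real m * flat 2 (real m * t - 1)) * cutoff m W * W * log_weight d t
        - cutoff m t * (real m * W * flat 2 (real m * W - 1) + cutoff m W)"
    using t \<open>L \<noteq> 0\<close> by (simp add: D_def field_simps)
  finally show ?thesis .
qed

text \<open>With the cut-off \<open>\<theta>\<^sub>m\<close>, derivatives occur only as \<open>y \<theta>\<^sub>m'(y)\<close>, up to factors
  that are bounded in \<open>m\<close>, and this product tends to zero for fixed \<open>y > 0\<close>.\<close>
lemma approx_field_tendsto:
  fixes x :: "real^'n"
  assumes "d > 0" "x \<in> ball 0 (1 / exp 1)"
  shows "(\<lambda>m. approx_field d m x) \<longlonglongrightarrow> - x"
proof (cases "x = 0")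
  case True
  have "radial_approx d m 0 = 0" for m by (simp add: radial_approx_def)
  moreover have "grad (\<lambda>x::real^'n. radial_approx d m (x \<bullet> x)) 0 = 0" if m: "m > 0" for m
  proof -
    obtain D where "(radial_approx d m has_real_derivative D) (at ((0::real^'n) \<bullet> 0))"
      using Cn_on_radial_approx[OF assms(1) m, of "Suc 0"] by auto
    from grad_radial[OF this] show ?thesis by simp
  qed
  ultimately have "approx_field d m x = 0" if "m > 0" for m
    using that True by (simp add: approx_field_def)
  then show ?thesis
    using True by (intro tendsto_eventually) (auto simp: eventually_sequentially intro!: exI[of _ 1])
next
  case False
  define t W where "t = x \<bullet> x" and "W = profile d t"
  have t: "0 < t" "t < exp (-2)"
    using False inner_self_less_exp_neg_2[OF assms(2)] by (auto simp: t_def)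
  have W: "0 < W" using profile_bounds(1)[OF assms(1) t] by (simp add: W_def)
  have "(\<lambda>m. (2 * ((real m * t * flat 2 (real m * t - 1)) / t) * cutoff m W * W * log_weight d t
        - cutoff m t * (real m * W * flat 2 (real m * W - 1) + cutoff m W)) *\<^sub>R x)
      \<longlonglongrightarrow> (2 * (0 / t) * 1 * W * log_weight d t - 1 * (0 + 1)) *\<^sub>R x"
    using t W by (intro tendsto_intros flat_2_tendsto cutoff_tendsto) auto
  then show ?thesis
    using approx_field_eq[OF assms(2) False, folded t_def] t by (simp add: W_def)
qed

text \<open>By \<open>flat_2_le_2\<close> the derivative of the cut-off in \<open>t\<close> is at most \<open>2 / t\<close>. It contributes
  at most \<open>4 L powr d / r\<close>, while all other terms are bounded by \<open>3 r\<close>.\<close>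
lemma norm_approx_field_le:
  fixes x :: "real^'n"
  assumes "d > 0" "x \<in> ball 0 (1 / exp 1)" "x \<noteq> 0"
  shows "norm (approx_field d m x) \<le> (4 * (4 * d) powr d + 3) * norm x powr (- (5 / 4))"
proof -
  define r t W where "r = norm x" and "t = x \<bullet> x" and "W = profile d t"
  have t: "0 < t" "t < exp (-2)"
    using assms(3) inner_self_less_exp_neg_2[OF assms(2)] by (auto simp: t_def)
  have r: "0 < r" "r < 1" "t = r * r"
    using assms(2,3) by (auto simp: r_def t_def power2_norm_eq_inner[symmetric] power2_eq_square
        intro: less_trans)
  have W: "0 < W" "W \<le> 1"
    using profile_bounds(1)[OF assms(1) t] profile_le_1[OF assms(1) t] by (simp_all add: W_def)
  have key: "0 \<le> real m * y * flat 2 (real m * y - 1)" "real m * y * flat 2 (real m * y - 1) \<le> 2"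
    if "y > 0" for y
    using flat_2_le_2[of "real m * y - 1"] that flat_nonneg[of 2 "real m * y - 1"] by auto
  define A where "A = (4 * d) powr d"
  have w: "0 \<le> log_weight d t" "log_weight d t \<le> A * r powr (- (1 / 4))"
    using neg_ln_powr_le[OF assms(1) r(1,2)] ln_inner_self[OF assms(3)]
    by (auto simp: log_weight_def t_def r_def A_def)
  \<comment> \<open>\<open>y\<close> times the derivative of the cut-off, at \<open>y = t\<close> and \<open>y = W\<close>\<close>
  define p where "p = real m * t * flat 2 (real m * t - 1)"
  define s where "s = real m * W * flat 2 (real m * W - 1)"
  have p: "0 \<le> p" "p \<le> 2" and s: "0 \<le> s" "s \<le> 2"
    using key t W by (auto simp: p_def s_def)
  have "approx_field d m x = (2 * (p / t) * cutoff m W * W * log_weight d t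
        - cutoff m t * (s + cutoff m W)) *\<^sub>R x"
    using approx_field_eq[OF assms(2,3), of d m, folded t_def] t
    by (simp add: p_def s_def W_def)
  then have "norm (approx_field d m x)
      = \<bar>2 * (p / t) * cutoff m W * W * log_weight d t - cutoff m t * (s + cutoff m W)\<bar> * r"
    by (simp add: r_def)
  also have "\<dots> \<le> (2 * (2 / t) * 1 * 1 * (A * r powr (- (1 / 4))) + 1 * (2 + 1)) * r"
  proof (intro mult_right_mono order_trans[OF abs_triangle_ineq4] add_mono)
    show "\<bar>2 * (p / t) * cutoff m W * W * log_weight d t\<bar>
        \<le> 2 * (2 / t) * 1 * 1 * (A * r powr (- (1 / 4)))"
    proof -
      have "2 * (p / t) * cutoff m W * W * log_weight d t
          \<le> 2 * (2 / t) * 1 * 1 * (A * r powr (- (1 / 4)))"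
        by (intro mult_mono divide_right_mono order_refl mult_nonneg_nonneg divide_nonneg_nonneg)
          (use p t W w cutoff_range[of m W] in simp_all)
      moreover have "0 \<le> 2 * (p / t) * cutoff m W * W * log_weight d t"
        using p t W w cutoff_range[of m W] by simp
      ultimately show ?thesis by simp
    qed
    show "\<bar>cutoff m t * (s + cutoff m W)\<bar> \<le> 1 * (2 + 1)"
    proof -
      have "cutoff m t * (s + cutoff m W) \<le> 1 * (2 + 1)"
        by (intro mult_mono add_mono) (use s cutoff_range[of m W] cutoff_range[of m t] in simp_all)
      then show ?thesis using s cutoff_range[of m W] cutoff_range[of m t] by simp
    qed
  qed (use r in auto)
  also have "\<dots> = 4 * A * (r powr (- (1 / 4)) / r) + 3 * r"
    using r by (simp add: field_simps)
  also have "r powr (- (1 / 4)) / r = r powr (- (5 / 4))"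
    using r powr_diff[of r "- (1 / 4)" 1] by simp
  also have "3 * r \<le> 3 * r powr (- (5 / 4))"
    using r powr_mono'[of "- (5 / 4)" 1 r] by simp
  finally show ?thesis by (simp add: A_def r_def algebra_simps)
qed

section \<open>Duality\<close>

lemma lborel_nn_integral_swap:
  fixes f :: "'a::euclidean_space \<Rightarrow> 'a \<Rightarrow> ennreal"
  assumes "(\<lambda>(x, y). f x y) \<in> borel_measurable (borel \<Otimes>\<^sub>M borel)"
  shows "(\<integral>\<^sup>+x. \<integral>\<^sup>+y. f x y \<partial>lborel \<partial>lborel) = (\<integral>\<^sup>+y. \<integral>\<^sup>+x. f x y \<partial>lborel \<partial>lborel)"
  using lborel_pair.Fubini'[of f] assms by (simp cong: measurable_cong_sets)

text \<open>The zero boundary values enter here: for test functions the identity is the divergence theorem, and it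
  passes to limits in \<open>L\<^sup>2\<close> because the position vector is bounded. The weak gradient of \<open>u\<close> alone
  would not suffice, as \<open>x\<close> is not compactly supported in the ball.\<close>
lemma W12_0_integral_inner_position:
  fixes u :: "real^'n \<Rightarrow> real" and G :: "real^'n \<Rightarrow> real^'n"
  assumes "W12_0 (ball 0 r) u G" "r \<le> 1"
  shows "(\<integral>x. G x \<bullet> x \<partial>lebesgue_on (ball 0 r)) = - real CARD('n) * (\<integral>x. u x \<partial>lebesgue_on (ball 0 r))"
proof -
  let ?B = "ball 0 r :: (real^'n) set"
  interpret finite_measure "lebesgue_on ?B"
    by (rule finite_measure_lebesgue_on) simp
  obtain \<phi> where \<phi>: "\<And>k::nat. \<phi> k \<in> test_functions ?B"
    and lim: "(\<lambda>k. \<integral>x. (\<phi> k x - u x)\<^sup>2 \<partial>lebesgue_on ?B) \<longlonglongrightarrow> 0"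
      "(\<lambda>k. \<integral>x. (norm (grad (\<phi> k) x - G x))\<^sup>2 \<partial>lebesgue_on ?B) \<longlonglongrightarrow> 0"
    using assms unfolding W12_0_def by blast
  have u: "u \<in> borel_measurable (lebesgue_on ?B)" "integrable (lebesgue_on ?B) (\<lambda>x. (norm (u x))\<^sup>2)"
    and G: "G \<in> borel_measurable (lebesgue_on ?B)" "integrable (lebesgue_on ?B) (\<lambda>x. (norm (G x))\<^sup>2)"
    using assms unfolding W12_0_def L2_space_def by auto
  have bor: "\<phi> k \<in> borel_measurable borel" "grad (\<phi> k) \<in> borel_measurable borel" for k
    using test_function_continuous[OF \<phi>] by (auto intro: borel_measurable_continuous_onI)
  have sq: "integrable (lebesgue_on ?B) (\<lambda>x. (norm (\<phi> k x))\<^sup>2)"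
    "integrable (lebesgue_on ?B) (\<lambda>x. (norm (grad (\<phi> k) x))\<^sup>2)" for k
  proof -
    obtain M where M: "M > 0" "\<And>x. \<bar>\<phi> k x\<bar> \<le> M" "\<And>x. norm (grad (\<phi> k) x) \<le> M"
      using test_function_bounds[OF \<phi>] by metis
    show "integrable (lebesgue_on ?B) (\<lambda>x. (norm (\<phi> k x))\<^sup>2)"
      by (rule integrable_const_bound[where B = "M\<^sup>2"])
        (use M bor in \<open>auto intro!: borel_measurable_lebesgue_onI power_mono simp: abs_le_square_iff[symmetric]\<close>)
    show "integrable (lebesgue_on ?B) (\<lambda>x. (norm (grad (\<phi> k) x))\<^sup>2)"
      by (rule integrable_const_bound[where B = "M\<^sup>2"])
        (use M bor in \<open>auto intro!: borel_measurable_lebesgue_onI power_mono\<close>)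
  qed
  have "(\<lambda>k. \<integral>x. \<phi> k x \<bullet> 1 \<partial>lebesgue_on ?B) \<longlonglongrightarrow> (\<integral>x. u x \<bullet> 1 \<partial>lebesgue_on ?B)"
    by (rule integral_inner_tendsto_if_L2_tendsto)
      (use u bor sq lim in \<open>auto intro: borel_measurable_lebesgue_onI\<close>)
  then have limu: "(\<lambda>k. - real CARD('n) * (\<integral>x. \<phi> k x \<partial>lebesgue_on ?B))
      \<longlonglongrightarrow> - real CARD('n) * (\<integral>x. u x \<partial>lebesgue_on ?B)"
    by (intro tendsto_mult_left) simp
  have limG: "(\<lambda>k. \<integral>x. grad (\<phi> k) x \<bullet> x \<partial>lebesgue_on ?B) \<longlonglongrightarrow> (\<integral>x. G x \<bullet> x \<partial>lebesgue_on ?B)"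
    by (rule integral_inner_tendsto_if_L2_tendsto)
      (use G bor sq lim assms(2) in \<open>auto intro: borel_measurable_lebesgue_onI\<close>)
  have "(\<integral>x. grad (\<phi> k) x \<bullet> x \<partial>lebesgue_on ?B) = - real CARD('n) * (\<integral>x. \<phi> k x \<partial>lebesgue_on ?B)" for k
  proof -
    have z: "\<phi> k x = 0" "grad (\<phi> k) x = 0" if "x \<notin> ?B" for x
    proof -
      have "x \<notin> closure {x. \<phi> k x \<noteq> 0}" using that \<phi>[of k] unfolding test_functions_def by auto
      then show "\<phi> k x = 0" "grad (\<phi> k) x = 0" by (rule test_function_zero[OF \<phi>])+
    qed
    have "(\<integral>x. grad (\<phi> k) x \<bullet> x \<partial>lebesgue_on ?B) = (\<integral>x. grad (\<phi> k) x \<bullet> x \<partial>lborel)"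
      using z bor by (intro integral_lebesgue_on_eq_lborel) auto
    also have "\<dots> = - real CARD('n) * (\<integral>x. \<phi> k x \<partial>lborel)"
      by (rule integral_grad_inner_position[OF \<phi>])
    also have "(\<integral>x. \<phi> k x \<partial>lborel) = (\<integral>x. \<phi> k x \<partial>lebesgue_on ?B)"
      using z bor by (intro integral_lebesgue_on_eq_lborel[symmetric]) auto
    finally show ?thesis .
  qed
  with limG limu show ?thesis using LIMSEQ_unique by simp
qed

text \<open>The function \<open>\<Phi> = W L powr d\<close>, which solves \<open>- div (\<nabla>\<Phi> + d c \<Phi>) = n\<close> away from the origin and vanishes on the boundary.\<close>
definition dual_weight :: "real \<Rightarrow> real^'n \<Rightarrow> real" where
  "dual_weight d x = profile d (x \<bullet> x) * log_weight d (x \<bullet> x)"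

lemma dual_weight_bounds:
  fixes x :: "real^'n"
  assumes "d > 0" "x \<in> ball 0 (1 / exp 1)" "x \<noteq> 0"
  shows "0 \<le> dual_weight d x" "dual_weight d x \<le> (4 * d) powr d * norm x powr (- (5 / 4))"
proof -
  have t: "0 < x \<bullet> x" "x \<bullet> x < exp (-2)"
    using assms(3) inner_self_less_exp_neg_2[OF assms(2)] by auto
  have r: "0 < norm x" "norm x < 1" using assms(2,3) by (auto intro: less_trans)
  have W: "0 < profile d (x \<bullet> x)" "profile d (x \<bullet> x) \<le> 1"
    using profile_bounds(1)[OF assms(1) t] profile_le_1[OF assms(1) t] by simp_all
  have w: "0 \<le> log_weight d (x \<bullet> x)" by (simp add: log_weight_def)
  show "0 \<le> dual_weight d x" using W w by (simp add: dual_weight_def)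
  have "dual_weight d x \<le> 1 * log_weight d (x \<bullet> x)"
    unfolding dual_weight_def using W w by (intro mult_right_mono) auto
  also have "\<dots> \<le> (4 * d) powr d * norm x powr (- (1 / 4))"
    using neg_ln_powr_le[OF assms(1) r] ln_inner_self[OF assms(3)] by (simp add: log_weight_def)
  also have "\<dots> \<le> (4 * d) powr d * norm x powr (- (5 / 4))"
    using r by (intro mult_left_mono powr_mono') auto
  finally show "dual_weight d x \<le> (4 * d) powr d * norm x powr (- (5 / 4))" .
qed

lemma AE_lebesgue_on_neq: "AE x in lebesgue_on S. x \<noteq> (a::'a::euclidean_space)" if "S \<in> sets lebesgue"
proof -
  have "AE x in lebesgue. x \<noteq> a"
    by (rule AE_I'[of "{a}"]) auto
  then show ?thesis using that by (subst AE_restrict_space_iff) (auto elim: AE_mp)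
qed

lemma radial_approx_tendsto_dual_weight:
  fixes x :: "real^'n"
  assumes "d > 0" "x \<in> ball 0 (1 / exp 1)"
  shows "(\<lambda>m. radial_approx d m (x \<bullet> x)) \<longlonglongrightarrow> dual_weight d x"
proof (cases "x = 0")
  case True
  \<comment> \<open>both sides vanish at the origin because \<open>ln 0 = 0\<close>\<close>
  then show ?thesis by (simp add: radial_approx_def dual_weight_def log_weight_def)
next
  case False
  have t: "0 < x \<bullet> x" "x \<bullet> x < exp (-2)"
    using False inner_self_less_exp_neg_2[OF assms(2)] by auto
  have "(\<lambda>m. cutoff m (x \<bullet> x) * cutoff m (profile d (x \<bullet> x)) * profile d (x \<bullet> x)
      * log_weight d (x \<bullet> x)) \<longlonglongrightarrow> 1 * 1 * profile d (x \<bullet> x) * log_weight d (x \<bullet> x)"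
    by (intro tendsto_intros cutoff_tendsto t profile_bounds(1) assms)
  then show ?thesis using t by (simp add: radial_approx_def dual_weight_def)
qed

lemma norm_radial_approx_le_dual_weight:
  fixes x :: "real^'n"
  assumes "d > 0" "x \<in> ball 0 (1 / exp 1)" "x \<noteq> 0"
  shows "\<bar>radial_approx d m (x \<bullet> x)\<bar> \<le> dual_weight d x"
proof -
  have t: "0 < x \<bullet> x" "x \<bullet> x < exp (-2)"
    using assms(3) inner_self_less_exp_neg_2[OF assms(2)] by auto
  let ?c = "cutoff m (x \<bullet> x) * cutoff m (profile d (x \<bullet> x))"
  have c: "0 \<le> ?c" "?c \<le> 1"
    using cutoff_range by (auto intro: mult_le_one)
  have "radial_approx d m (x \<bullet> x) = ?c * dual_weight d x"
    using t by (simp add: radial_approx_def dual_weight_def)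
  then show ?thesis
    using c dual_weight_bounds(1)[OF assms] by (simp add: abs_mult mult_left_le_one_le)
qed

text \<open>Testing with the approximations \<open>\<phi>\<^sub>m\<close> gives
  \<open>\<integral>G \<bullet> (\<nabla>\<phi>\<^sub>m + d c \<phi>\<^sub>m) = \<integral>f \<phi>\<^sub>m\<close>,
  where \<open>G\<close> is the gradient of \<open>u\<close>. By dominated convergence the two sides tend to
  \<open>- \<integral>G \<bullet> x = n \<integral>u\<close> and to \<open>\<integral>f \<Phi>\<close>.\<close>
lemma adjoint_solution_duality:
  fixes u f :: "real^'n \<Rightarrow> real"
  assumes n: "CARD('n) \<ge> 3" and d: "d > 0"
    and sol: "adjoint_solution (ball 0 (1 / exp 1)) (\<lambda>x. d *\<^sub>R log_drift x) f u"
    and f: "bounded_cpt_supp (ball 0 (1 / exp 1)) f"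
  shows "integrable (lebesgue_on (ball 0 (1 / exp 1))) u"
    "integrable (lebesgue_on (ball 0 (1 / exp 1))) (\<lambda>x. f x * dual_weight d x)"
    "real CARD('n) * (\<integral>x. u x \<partial>lebesgue_on (ball 0 (1 / exp 1)))
      = (\<integral>x. f x * dual_weight d x \<partial>lebesgue_on (ball 0 (1 / exp 1)))"
proof -
  let ?B = "ball 0 (1 / exp 1) :: (real^'n) set"
  let ?M = "lebesgue_on ?B"
  interpret finite_measure ?M by (rule finite_measure_lebesgue_on) simp
  have B1: "?B \<subseteq> ball 0 1" by (rule subset_ball) simp
  obtain G where W: "W12_0 ?B u G"
    and eq: "\<And>\<phi>. \<phi> \<in> test_functions ?B \<Longrightarrow>
      (\<integral>x. G x \<bullet> grad \<phi> x + ((d *\<^sub>R log_drift x) \<bullet> G x) * \<phi> x \<partial>?M) = (\<integral>x. f x * \<phi> x \<partial>?M)"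
    using sol unfolding adjoint_solution_def by blast
  have u: "u \<in> borel_measurable ?M" "integrable ?M (\<lambda>x. (norm (u x))\<^sup>2)"
    and G: "G \<in> borel_measurable ?M" "integrable ?M (\<lambda>x. (norm (G x))\<^sup>2)"
    using W unfolding W12_0_def L2_space_def by auto
  note [measurable] = G(1)
  show "integrable ?M u" by (rule integrable_norm_if_square_integrable[OF u])
  have fm: "f \<in> borel_measurable ?M"
    using f unfolding bounded_cpt_supp_def by (auto intro: measurable_restrict_space1)
  obtain A where A: "\<And>x. \<bar>f x\<bar> \<le> A"
    using f unfolding bounded_cpt_supp_def bounded_iff by auto
  have A0: "0 \<le> A" using A[of 0] by linarith
  note [measurable] = fm
  have pow: "integrable ?M (\<lambda>x. norm x powr - a)" if "0 \<le> a" "a < 3" for a :: real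
    using that n by (intro integrable_norm_powr_lebesgue_on B1) auto
  \<comment> \<open>majorant of \<open>f \<phi>\<^sub>m\<close>\<close>
  let ?w = "\<lambda>x::real^'n. A * ((4 * d) powr d * norm x powr - (5 / 4))"
  have w: "integrable ?M ?w" using pow[of "5 / 4"] by simp
  let ?\<phi> = "\<lambda>m (x::real^'n). radial_approx d m (x \<bullet> x)"
  have \<phi>: "?\<phi> (Suc m) \<in> test_functions ?B" for m
    by (rule radial_approx_test_function[OF d]) simp
  have \<phi>m[measurable]: "?\<phi> (Suc m) \<in> borel_measurable ?M" for m
    by (intro borel_measurable_lebesgue_onI borel_measurable_continuous_onI
        test_function_continuous(1)[OF \<phi>])
  have \<phi>gm[measurable]: "grad (?\<phi> (Suc m)) \<in> borel_measurable ?M" for m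
    by (intro borel_measurable_lebesgue_onI borel_measurable_continuous_onI
        test_function_continuous(2)[OF \<phi>])
  have ae: "AE x in ?M. x \<in> ?B \<and> x \<noteq> 0"
    using AE_lebesgue_on_neq[of ?B 0] by (auto simp: AE_space elim!: AE_mp intro!: AE_I2)
  note [measurable] = borel_measurable_log_drift
  have dwm[measurable]: "dual_weight d \<in> borel_measurable ?M"
  proof (rule borel_measurable_LIMSEQ_real[OF _ \<phi>m])
    show "(\<lambda>m. ?\<phi> (Suc m) x) \<longlonglongrightarrow> dual_weight d x" if "x \<in> space ?M" for x
      using that LIMSEQ_Suc[OF radial_approx_tendsto_dual_weight[OF d, of x]] by simp
  qed
  show fint: "integrable ?M (\<lambda>x. f x * dual_weight d x)"
  proof (rule Bochner_Integration.integrable_bound[OF w])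
    show "AE x in ?M. norm (f x * dual_weight d x) \<le> norm (?w x)"
      using ae
    proof eventually_elim
      case (elim x)
      then have "\<bar>f x\<bar> * \<bar>dual_weight d x\<bar> \<le> ?w x"
        using dual_weight_bounds[OF d, of x] A A0 by (intro mult_mono) auto
      then show ?case using A0 by (simp add: abs_mult)
    qed
  qed measurable
  have lim1: "(\<lambda>m. \<integral>x. f x * ?\<phi> (Suc m) x \<partial>?M) \<longlonglongrightarrow> (\<integral>x. f x * dual_weight d x \<partial>?M)"
  proof (rule integral_dominated_convergence[OF _ _ w])
    show "AE x in ?M. (\<lambda>m. f x * ?\<phi> (Suc m) x) \<longlonglongrightarrow> f x * dual_weight d x"
      using ae
    proof eventually_elim
      case (elim x)
      then show ?case
        by (intro tendsto_mult_left LIMSEQ_Suc radial_approx_tendsto_dual_weight[OF d]) auto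
    qed
    show "AE x in ?M. norm (f x * ?\<phi> (Suc m) x) \<le> ?w x" for m
      using ae
    proof eventually_elim
      case (elim x)
      then have "\<bar>f x\<bar> * \<bar>?\<phi> (Suc m) x\<bar> \<le> ?w x"
        using norm_radial_approx_le_dual_weight[OF d, of x "Suc m"] dual_weight_bounds[OF d, of x] A A0
        by (intro mult_mono) auto
      then show ?case by (simp add: abs_mult)
    qed
  qed measurable
  let ?K = "4 * (4 * d) powr d + 3"
  \<comment> \<open>majorant of \<open>G \<bullet> (\<nabla>\<phi>\<^sub>m + d c \<phi>\<^sub>m)\<close>, by \<open>a b \<le> (a\<^sup>2 + b\<^sup>2) / 2\<close>; integrable since \<open>5 / 2 < n\<close>\<close>
  let ?v = "\<lambda>x. ((norm (G x))\<^sup>2 + ?K\<^sup>2 * norm x powr - (5 / 2)) / 2"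
  have v: "integrable ?M ?v" using pow[of "5 / 2"] G(2) by simp
  have "(\<lambda>m. \<integral>x. G x \<bullet> approx_field d (Suc m) x \<partial>?M) \<longlonglongrightarrow> (\<integral>x. G x \<bullet> (- x) \<partial>?M)"
  proof (rule integral_dominated_convergence[OF _ _ v])
    show "AE x in ?M. (\<lambda>m. G x \<bullet> approx_field d (Suc m) x) \<longlonglongrightarrow> G x \<bullet> (- x)"
      using ae
    proof eventually_elim
      case (elim x)
      then show ?case by (intro tendsto_inner tendsto_const LIMSEQ_Suc approx_field_tendsto[OF d]) auto
    qed
    show "AE x in ?M. norm (G x \<bullet> approx_field d (Suc m) x) \<le> ?v x" for m
      using ae
    proof eventually_elim
      case (elim x)
      let ?F = "approx_field d (Suc m) x"
      have "norm ?F \<le> ?K * norm x powr - (5 / 4)"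
        using elim by (intro norm_approx_field_le[OF d]) auto
      then have "(norm ?F)\<^sup>2 \<le> (?K * norm x powr - (5 / 4))\<^sup>2" by (intro power_mono) auto
      also have "\<dots> = ?K\<^sup>2 * norm x powr - (5 / 2)"
        by (simp add: power_mult_distrib power2_eq_square[of "norm x powr _"] powr_add[symmetric])
      finally have F: "(norm ?F)\<^sup>2 \<le> ?K\<^sup>2 * norm x powr - (5 / 2)" .
      have "norm (G x \<bullet> ?F) \<le> norm (G x) * norm ?F"
        using Cauchy_Schwarz_ineq2[of "G x" ?F] by simp
      also have "\<dots> \<le> ((norm (G x))\<^sup>2 + (norm ?F)\<^sup>2) / 2"
        using sum_squares_bound[of "norm (G x)" "norm ?F"] by simp
      finally show ?case using F by simp
    qed
    show "(\<lambda>x. G x \<bullet> approx_field d (Suc m) x) \<in> borel_measurable ?M" for m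
      unfolding approx_field_def by measurable
    have "(\<lambda>x::real^'n. x) \<in> borel_measurable ?M"
      by (intro borel_measurable_lebesgue_onI) simp
    then show "(\<lambda>x. G x \<bullet> (- x)) \<in> borel_measurable ?M" by measurable
  qed
  moreover have "(\<integral>x. G x \<bullet> approx_field d (Suc m) x \<partial>?M) = (\<integral>x. f x * ?\<phi> (Suc m) x \<partial>?M)" for m
    unfolding eq[OF \<phi>, symmetric] approx_field_def
    by (intro Bochner_Integration.integral_cong) (simp_all add: inner_add_right inner_commute algebra_simps)
  ultimately have "(\<lambda>m. \<integral>x. f x * ?\<phi> (Suc m) x \<partial>?M) \<longlonglongrightarrow> (\<integral>x. G x \<bullet> (- x) \<partial>?M)"
    by simp
  with lim1 have "(\<integral>x. f x * dual_weight d x \<partial>?M) = (\<integral>x. G x \<bullet> (- x) \<partial>?M)"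
    by (rule LIMSEQ_unique)
  also have "\<dots> = real CARD('n) * (\<integral>x. u x \<partial>?M)"
    using W12_0_integral_inner_position[OF W] by simp
  finally show "real CARD('n) * (\<integral>x. u x \<partial>?M) = (\<integral>x. f x * dual_weight d x \<partial>?M)" by simp
qed

section \<open>Failure of the pointwise bound\<close>

text \<open>For \<open>t \<le> exp (- 3)\<close> the profile is at least its value at \<open>exp (- 3)\<close>, while
  \<open>L powr d\<close> tends to infinity.\<close>
lemma dual_weight_unbounded_at_0:
  assumes d: "d > 0"
  obtains \<epsilon> where "\<epsilon> > 0" "\<epsilon> < 1 / exp 1"
    "\<And>x::real^'n. norm x \<le> \<epsilon> \<Longrightarrow> x \<noteq> 0 \<Longrightarrow> M \<le> dual_weight d x"
proof -
  define w where "w = profile d (exp (- 3))"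
  have w: "w > 0" unfolding w_def by (rule profile_bounds(1)[OF d]) auto
  \<comment> \<open>the size of \<open>L powr d\<close> that is needed\<close>
  define a where "a = max 0 M / w"
  have a: "a \<ge> 0" "a * w \<ge> M" using w by (auto simp: a_def)
  define \<epsilon> where "\<epsilon> = min (exp (- 3 / 2)) (exp (- (a powr (1 / d))))"
  have e0: "\<epsilon> > 0" by (simp add: \<epsilon>_def)
  have e1: "\<epsilon> < 1 / exp 1"
  proof -
    have "\<epsilon> \<le> exp (- 3 / 2)" unfolding \<epsilon>_def by (rule min.cobounded1)
    also have "\<dots> < exp (- 1)" by simp
    finally have "\<epsilon> < exp (- 1)" .
    then show ?thesis by (simp add: exp_minus divide_inverse)
  qed
  show ?thesis
  proof (rule that[OF e0 e1])
    fix x :: "real^'n" assume x: "norm x \<le> \<epsilon>" "x \<noteq> 0"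
    define t where "t = x \<bullet> x"
    have t0: "t > 0" using x by (simp add: t_def)
    have "(norm x)\<^sup>2 \<le> (exp (- 3 / 2))\<^sup>2"
      using x by (intro power_mono) (auto simp: \<epsilon>_def)
    then have t3: "t \<le> exp (- 3)"
      by (simp add: t_def power2_norm_eq_inner exp_double[symmetric])
    have "w \<le> profile d t"
      unfolding w_def profile_def
      by (rule integral_subset_le)
        (use t3 t0 profile_integrable[of "exp (-3)" d] profile_integrable[OF t0, of d] in
          \<open>auto simp: log_weight_def\<close>)
    moreover have "a \<le> log_weight d t"
    proof -
      have "ln (norm x) \<le> ln \<epsilon>"
        using x e0 by (subst ln_le_cancel_iff) auto
      also have "\<dots> \<le> ln (exp (- (a powr (1 / d))))"
        using e0 by (subst ln_le_cancel_iff) (auto simp: \<epsilon>_def)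
      finally have "a powr (1 / d) \<le> - ln t / 2"
        using ln_inner_self[OF x(2)] by (simp add: t_def)
      then have "(a powr (1 / d)) powr d \<le> (- ln t / 2) powr d"
        using d by (intro powr_mono2) auto
      then show ?thesis using d a by (simp add: powr_powr log_weight_def)
    qed
    ultimately have "w * a \<le> dual_weight d x"
      unfolding dual_weight_def t_def[symmetric] using w a by (intro mult_mono) auto
    then show "M \<le> dual_weight d x" using a by (simp add: mult.commute)
  qed
qed

lemma bounded_cpt_supp_indicator_cball:
  assumes "\<epsilon> < r"
  shows "bounded_cpt_supp (ball 0 r) (indicator (cball 0 \<epsilon>) :: real^'n \<Rightarrow> real)"
proof -
  have "{x. indicator (cball 0 \<epsilon>) x \<noteq> (0::real)} = cball (0::real^'n) \<epsilon>"
    by (auto simp: indicator_def)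
  moreover have "cball (0::real^'n) \<epsilon> \<subseteq> ball 0 r" using assms by auto
  moreover have "bounded (range (indicator (cball (0::real^'n) \<epsilon>) :: _ \<Rightarrow> real))"
    by (rule boundedI[of _ 1]) (auto simp: indicator_def)
  moreover have "(indicator (cball (0::real^'n) \<epsilon>) :: _ \<Rightarrow> real) \<in> borel_measurable lebesgue"
    by (rule borel_measurable_indicator) simp
  ultimately show ?thesis by (simp add: bounded_cpt_supp_def)
qed

text \<open>The bound on \<open>g\<close> is integrated first in \<open>x\<close>, by Tonelli: the integral of
  \<open>|y - x| powr - a\<close> over the ball is at most \<open>K\<close> for every pole \<open>y\<close> in the support of the
  indicator.\<close>
lemma integral_kernel_average_le:
  fixes g :: "real^'n \<Rightarrow> real^'n \<Rightarrow> real" and a r \<epsilon> C :: real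
  defines "B \<equiv> ball (0 :: real^'n) r"
  assumes a: "0 \<le> a" "a < CARD('n)" and C: "C > 0" and r: "r + \<epsilon> \<le> 1" and \<epsilon>: "\<epsilon> < r"
    and bound: "AE x in lebesgue_on B. AE y in lebesgue_on B. g y x \<le> C * norm (y - x) powr - a"
  defines "K \<equiv> enn2real (\<integral>\<^sup>+z\<in>ball (0::real^'n) 1. ennreal (norm z powr - a) \<partial>lborel)"
  shows "(\<integral>x. (\<integral>y. g y x * indicator (cball 0 \<epsilon>) y \<partial>lebesgue_on B) \<partial>lebesgue_on B)
      \<le> C * K * measure lborel (cball (0::real^'n) \<epsilon>)"
proof -
  let ?I = "indicator (cball (0::real^'n) \<epsilon>)"
  have Bs: "B \<in> sets lebesgue" by (simp add: B_def)
  have [measurable]: "ball (0::real^'n) r \<in> sets borel" by simp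
  let ?k = "\<lambda>x y. ennreal (C * norm (y - x) powr - a) * (?I y * indicator B x)"
  have K: "(\<integral>\<^sup>+z\<in>ball (0::real^'n) 1. ennreal (norm z powr - a) \<partial>lborel) = ennreal K"
    using nn_integral_norm_powr_unit_ball_finite[where 'a = "real^'n", of a] a
    by (simp add: K_def less_top)
  have "ennreal (\<integral>x. (\<integral>y. g y x * ?I y \<partial>lebesgue_on B) \<partial>lebesgue_on B)
      \<le> (\<integral>\<^sup>+x. ennreal (\<integral>y. g y x * ?I y \<partial>lebesgue_on B) \<partial>lebesgue_on B)"
    by (rule ennreal_integral_le_nn_integral)
  also have "\<dots> \<le> (\<integral>\<^sup>+x. (\<integral>\<^sup>+y. ennreal (C * norm (y - x) powr - a) * ?I y \<partial>lebesgue_on B) \<partial>lebesgue_on B)"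
  proof (rule nn_integral_mono_AE, use bound in eventually_elim)
    case (elim x)
    have "ennreal (\<integral>y. g y x * ?I y \<partial>lebesgue_on B) \<le> (\<integral>\<^sup>+y. ennreal (g y x * ?I y) \<partial>lebesgue_on B)"
      by (rule ennreal_integral_le_nn_integral)
    also have "\<dots> \<le> (\<integral>\<^sup>+y. ennreal (C * norm (y - x) powr - a) * ?I y \<partial>lebesgue_on B)"
      by (rule nn_integral_mono_AE, use elim in eventually_elim) (auto simp: indicator_def intro: ennreal_leI)
    finally show ?case .
  qed
  also have "\<dots> \<le> (\<integral>\<^sup>+x. (\<integral>\<^sup>+y. ?k x y \<partial>lborel) \<partial>lborel)"
    unfolding nn_integral_lebesgue_on[OF Bs]
    by (intro nn_integral_mono) (auto simp: indicator_def intro!: nn_integral_mono)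
  also have "\<dots> = (\<integral>\<^sup>+y. (\<integral>\<^sup>+x. ?k x y \<partial>lborel) \<partial>lborel)"
  proof (rule lborel_nn_integral_swap)
    have [measurable]: "(\<lambda>p. indicator B (fst p) :: ennreal) \<in> borel_measurable (borel \<Otimes>\<^sub>M borel)"
      by (rule measurable_compose[OF measurable_fst borel_measurable_indicator]) (simp add: B_def)
    have [measurable]: "(\<lambda>p. ?I (snd p) :: ennreal) \<in> borel_measurable (borel \<Otimes>\<^sub>M borel)"
      by (rule measurable_compose[OF measurable_snd borel_measurable_indicator]) simp
    show "(\<lambda>(x, y). ?k x y) \<in> borel_measurable (borel \<Otimes>\<^sub>M borel)" by measurable
  qed
  also have "\<dots> \<le> (\<integral>\<^sup>+y. ennreal (C * K) * ?I y \<partial>lborel)"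
  proof (rule nn_integral_mono)
    fix y :: "real^'n"
    show "(\<integral>\<^sup>+x. ?k x y \<partial>lborel) \<le> ennreal (C * K) * ?I y"
    proof (cases "y \<in> cball 0 \<epsilon>")
      case True
      have "(\<integral>\<^sup>+x. ?k x y \<partial>lborel)
          = (\<integral>\<^sup>+x. ennreal C * (ennreal (norm (y - x) powr - a) * indicator (ball 0 r) x) \<partial>lborel)"
        using True C by (intro nn_integral_cong) (auto simp: B_def ennreal_mult indicator_def)
      also have "\<dots> = ennreal C * (\<integral>\<^sup>+x\<in>ball 0 r. ennreal (norm (y - x) powr - a) \<partial>lborel)"
        by (rule nn_integral_cmult) measurable
      also have "\<dots> \<le> ennreal C * ennreal K"
        unfolding K[symmetric]
        by (intro mult_left_mono nn_integral_norm_diff_powr_ball_le) (use True r in auto)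
      finally show ?thesis using True C by (simp add: ennreal_mult K_def)
    qed simp
  qed
  also have "\<dots> = ennreal (C * K * measure lborel (cball (0::real^'n) \<epsilon>))"
    using C emeasure_lborel_cball_finite[of "0::real^'n" \<epsilon>]
    by (simp add: nn_integral_cmult_indicator ennreal_mult K_def emeasure_eq_ennreal_measure)
  finally show ?thesis
    by (subst (asm) ennreal_le_iff) (use C in \<open>auto simp: K_def\<close>)
qed

text \<open>With \<open>f\<close> the indicator of a ball of volume \<open>v\<close> around \<open>0\<close> on which the dual weight is at least
  \<open>m\<close>, duality gives \<open>m v \<le> n \<integral>u \<le> n C K v\<close>, where \<open>C K v\<close> bounds the integral
  of the averaged kernel. The value \<open>m = n C K + 1\<close> is therefore contradictory.\<close>
lemma green_function_not_bounded:
  fixes g :: "real^'n \<Rightarrow> real^'n \<Rightarrow> real"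
  defines "B \<equiv> ball (0 :: real^'n) (1 / exp 1)"
  assumes n: "CARD('n) \<ge> 3" and d: "d > 0"
    and green: "is_green_function B (\<lambda>x. d *\<^sub>R log_drift x) g"
    and C: "C > 0"
  shows "\<not> (AE x in lebesgue_on B. AE y in lebesgue_on B.
      g y x \<le> C * norm (y - x) powr (2 - real CARD('n)))"
proof
  assume bound: "AE x in lebesgue_on B. AE y in lebesgue_on B.
      g y x \<le> C * norm (y - x) powr (2 - real CARD('n))"
  let ?M = "lebesgue_on B"
  define a where "a = real CARD('n) - 2"
  define K where "K = enn2real (\<integral>\<^sup>+z\<in>ball (0::real^'n) 1. ennreal (norm z powr - a) \<partial>lborel)"
  define m where "m = real CARD('n) * (C * K) + 1"
  obtain \<epsilon> where \<epsilon>: "\<epsilon> > 0" "\<epsilon> < 1 / exp 1"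
    and big: "\<And>x::real^'n. norm x \<le> \<epsilon> \<Longrightarrow> x \<noteq> 0 \<Longrightarrow> m \<le> dual_weight d x"
    using dual_weight_unbounded_at_0[OF d] by metis
  let ?f = "indicator (cball 0 \<epsilon>) :: real^'n \<Rightarrow> real"
  define u where "u = (\<lambda>x. \<integral>y. g y x * ?f y \<partial>?M)"
  define v where "v = measure lborel (cball (0::real^'n) \<epsilon>)"
  have v: "v > 0" using content_cball_pos[of \<epsilon> "0::real^'n"] \<epsilon> by (simp add: v_def)
  have f: "bounded_cpt_supp (ball 0 (1 / exp 1)) ?f"
    by (rule bounded_cpt_supp_indicator_cball[OF \<epsilon>(2)])
  have sol: "adjoint_solution (ball 0 (1 / exp 1)) (\<lambda>x. d *\<^sub>R log_drift x) ?f u"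
    using green f unfolding is_green_function_def B_def u_def by blast
  note dual = adjoint_solution_duality[OF n d sol f, folded B_def]
  have "m * v = (\<integral>x. m * ?f x \<partial>?M)"
  proof -
    have "(\<integral>x. ?f x \<partial>?M) = (\<integral>x. ?f x \<partial>lborel)"
      using \<epsilon> by (intro integral_lebesgue_on_eq_lborel) (auto simp: B_def indicator_def)
    then show ?thesis by (simp add: v_def)
  qed
  also have "\<dots> \<le> (\<integral>x. ?f x * dual_weight d x \<partial>?M)"
  proof (rule integral_mono_AE[OF _ dual(2)])
    interpret finite_measure ?M by (rule finite_measure_lebesgue_on) (simp add: B_def)
    show "integrable ?M (\<lambda>x. m * ?f x)"
      by (intro integrable_mult_right integrable_const_bound[of _ 1] borel_measurable_lebesgue_onI)
        (auto simp: indicator_def)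
    show "AE x in ?M. m * ?f x \<le> ?f x * dual_weight d x"
    proof -
      have "AE x in ?M. x \<noteq> 0" by (rule AE_lebesgue_on_neq) (simp add: B_def)
      then show ?thesis by eventually_elim (auto simp: indicator_def big)
    qed
  qed
  also have "\<dots> = real CARD('n) * (\<integral>x. u x \<partial>?M)" by (rule dual(3)[symmetric])
  also have "\<dots> \<le> real CARD('n) * (C * K * v)"
  proof (rule mult_left_mono)
    have "1 / exp 1 + \<epsilon> \<le> 1"
    proof -
      have "1 / exp 1 \<le> (1 / 2 :: real)" using exp_ge_add_one_self[of "1::real"] by (simp add: field_simps)
      then show ?thesis using \<epsilon>(2) by linarith
    qed
    then show "(\<integral>x. u x \<partial>?M) \<le> C * K * v"
      unfolding u_def v_def K_def B_def using \<epsilon> C n bound[unfolded B_def]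
      by (intro integral_kernel_average_le) (auto simp: a_def)
  qed simp
  also have "\<dots> = (m - 1) * v" by (simp add: m_def)
  finally have "m * v \<le> (m - 1) * v" .
  with v show False by (simp add: algebra_simps)
qed

theorem proposition6p3:
  fixes B :: "(real^'n) set"
    and c c\<delta> :: "real^'n \<Rightarrow> real^'n"
    and q :: ennreal
    and \<delta> :: real
  assumes "CARD('n) \<ge> 3"
    and "B = ball 0 (1 / exp 1)"
    and "q > 1"
    and "\<delta> > 0"
    and "c = (\<lambda>x. - ((1 / ((norm x)\<^sup>2 * ln (norm x))) *\<^sub>R x))"
    and "c\<delta> = (\<lambda>x. \<delta> *\<^sub>R c x)"
  shows "c\<delta> \<in> lorentz_space (real CARD('n)) q B
    \<and> lorentz_norm (real CARD('n)) q B c\<delta> \<le> ennreal \<delta> * lorentz_norm (real CARD('n)) q B c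
    \<and> (\<forall>g. is_green_function B c\<delta> g \<longrightarrow>
        \<not> (\<exists>C>0. AE x in lebesgue_on B. AE y in lebesgue_on B.
              g y x \<le> C * norm (y - x) powr (2 - real CARD('n))))"
proof (intro conjI allI impI)
  have c: "c = log_drift" using assms(5) by (simp add: log_drift_def fun_eq_iff)
  have c\<delta>: "c\<delta> = (\<lambda>x. \<delta> *\<^sub>R log_drift x)" using assms(6) c by simp
  show le: "lorentz_norm (real CARD('n)) q B c\<delta> \<le> ennreal \<delta> * lorentz_norm (real CARD('n)) q B c"
    unfolding c c\<delta> using assms(3,4) by (intro lorentz_norm_scaleR_le) (auto intro: less_trans[of 0 1])
  have "lorentz_norm (real CARD('n)) q B c < top"
    using lorentz_norm_log_drift_finite[OF assms(3), where 'a = "real^'n"] by (simp add: c assms(2))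
  then have "lorentz_norm (real CARD('n)) q B c\<delta> < top"
    by (intro le_less_trans[OF le]) (simp add: ennreal_mult_less_top)
  moreover have "c\<delta> \<in> borel_measurable (lebesgue_on B)"
    unfolding c\<delta> using borel_measurable_log_drift[of B] by measurable
  ultimately show "c\<delta> \<in> lorentz_space (real CARD('n)) q B" by (simp add: lorentz_space_def)
  fix g assume "is_green_function B c\<delta> g"
  then show "\<not> (\<exists>C>0. AE x in lebesgue_on B. AE y in lebesgue_on B.
      g y x \<le> C * norm (y - x) powr (2 - real CARD('n)))"
    using green_function_not_bounded[OF assms(1,4), of g] unfolding assms(2) c\<delta> by blast
qed

end
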